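(* Let $p$ be a prime number and let $r$ and $n$ be positive integers such that $p^{n-1}<r\le \frac{p-1}{2}\,p^{n-1}$. Then: (1) $c(r,s,p)=c(r,s+p^{n-1},p)$ for every integer $s$ satisfying $r\le s\le \left(p-\lceil r/p^{n-1}\rceil\right)p^{n-1}$; and (2) $c\left(r,\left(p-\lceil r/p^{n-1}\rceil\right)p^{n-1}+1,p\right)\ne c\left(r,\left(p-\lceil r/p^{n-1}\rceil+1\right)p^{n-1}+1,p\right)$, that is, the equality $c(r,s,p)=c(r,s+p^{n-1},p)$ fails at $s=\left(p-\lceil r/p^{n-1}\rceil\right)p^{n-1}+1$.
   Context: Let $p$ be a prime and $F$ a field of characteristic $p$. For a positive integer $m$, $J_m$ denotes the full $m\times m$ Jordan block matrix over $F$ with eigenvalue $1$. For positive integers $r\le s$, the Jordan canonical form of the $rs\times rs$ matrix $J_r\otimes J_s$ (Kronecker product) is $J_{\lambda_1}\oplus J_{\lambda_2}\oplus\cdots\oplus J_{\lambda_r}$ with exactly $r$ blocks, where $\lambda_1\ge\lambda_2\ge\cdots\ge\lambda_r>0$. The resulting partition $\lambda(r,s,p)=(\lambda_1,\dots,\lambda_r)$ of $rs$ is called the Jordan partition; it depends only on $r$, $s$ and $p$. Write $$\lambda(r,s,p)=(\overbrace{\mu_1,\dots,\mu_1}^{m_1},\overbrace{\mu_2,\dots,\mu_2}^{m_2},\dots,\overbrace{\mu_k,\dots,\mu_k}^{m_k}),\qquad \mu_1>\mu_2>\cdots>\mu_k>0,$$ with each $m_i\ge 1$. Then $c(r,s,p)$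 denotes the composition $(m_1,\dots,m_k)$ of $r$, i.e. the finite sequence of multiplicities of the distinct Jordan block sizes, listed in order of decreasing block size. Two compositions are equal if they are equal as finite sequences. $\lceil x\rceil$ denotes the least integer $\ge x$. *)

theory Defs
  imports
    Complex_Main
    "HOL-Computational_Algebra.Primes"
    "Jordan_Normal_Form.Jordan_Normal_Form_Existence"
    "Jordan_Normal_Form.Jordan_Normal_Form_Uniqueness"
begin

definition kronecker_mat :: "'a::times mat \<Rightarrow> 'a mat \<Rightarrow> 'a mat" where
  "kronecker_mat A B = mat (dim_row A * dim_row B) (dim_col A * dim_col B)
     (\<lambda>(i, j). A $$ (i div dim_row B, j div dim_col B) * B $$ (i mod dim_row B, j mod dim_col B))"

definition is_jordan_partition :: "'a::field itself \<Rightarrow> nat \<Rightarrow> nat \<Rightarrow> nat list \<Rightarrow> bool" where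
  "is_jordan_partition F r s \<nu> \<longleftrightarrow> sorted_wrt (\<ge>) \<nu> \<and>
     jordan_nf (kronecker_mat (jordan_block r (1::'a)) (jordan_block s 1)) (map (\<lambda>m. (m, 1)) \<nu>)"

(* The type argument stands for the base field. The definite description is justified for all
   r and s by ex1_jordan_partition below. *)
definition jordan_partition :: "'a::field itself \<Rightarrow> nat \<Rightarrow> nat \<Rightarrow> nat list" where
  "jordan_partition F r s = (THE \<nu>. is_jordan_partition F r s \<nu>)"

(* Equal parts of a weakly decreasing list are adjacent, so remdups_adj yields the distinct
   parts in decreasing order. *)
definition multiplicity_composition :: "nat list \<Rightarrow> nat list" where
  "multiplicity_composition \<nu> = map (count_list \<nu>) (remdups_adj \<nu>)"

definition jordan_composition :: "'a::field itself \<Rightarrow> nat \<Rightarrow> nat \<Rightarrow> nat list" where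
  "jordan_composition F r s = multiplicity_composition (jordan_partition F r s)"

lemma similar_four_block_swap:
  fixes A B :: "'a::comm_ring_1 mat"
  assumes A: "A \<in> carrier_mat n n" and B: "B \<in> carrier_mat m m"
  shows "similar_mat (four_block_mat A (0\<^sub>m n m) (0\<^sub>m m n) B) (four_block_mat B (0\<^sub>m m n) (0\<^sub>m n m) A)"
proof (rule similar_matI)
  let ?P = "four_block_mat (0\<^sub>m n m) (1\<^sub>m n) (1\<^sub>m m) (0\<^sub>m m n) :: 'a mat"
  let ?Q = "four_block_mat (0\<^sub>m m n) (1\<^sub>m m) (1\<^sub>m n) (0\<^sub>m n m) :: 'a mat"
  let ?L = "four_block_mat A (0\<^sub>m n m) (0\<^sub>m m n) B"
  let ?R = "four_block_mat B (0\<^sub>m m n) (0\<^sub>m n m) A"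
  have PC: "?P \<in> carrier_mat (n + m) (m + n)" and QC: "?Q \<in> carrier_mat (m + n) (n + m)"
    by (rule four_block_carrier_mat; simp)+
  show "{?L, ?R, ?P, ?Q} \<subseteq> carrier_mat (n + m) (n + m)"
    using A B PC QC by (auto simp: add.commute)
  show "?P * ?Q = 1\<^sub>m (n + m)"
    by (subst mult_four_block_mat[of _ n m _ n _ m _ _ n _ m]) auto
  show "?Q * ?P = 1\<^sub>m (n + m)"
    by (subst mult_four_block_mat[of _ m n _ m _ n _ _ m _ n]) (auto simp: add.commute)
  have PR: "?P * ?R = four_block_mat (0\<^sub>m n m) A B (0\<^sub>m m n)"
    using A B by (subst mult_four_block_mat[of _ n m _ n _ m _ _ m _ n]) auto
  show "?L = ?P * ?R * ?Q"
    unfolding PR using A B by (subst mult_four_block_mat[of _ n m _ n _ m _ _ n _ m]) auto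
qed

lemma similar_jordan_matrix_perm:
  fixes xs ys :: "(nat \<times> 'a::comm_ring_1) list"
  assumes "mset xs = mset ys"
  shows "similar_mat (jordan_matrix xs) (jordan_matrix ys)"
  using assms
proof (induction xs arbitrary: ys)
  case Nil
  then show ?case by (auto intro!: similar_mat_refl[of _ 0] simp: jordan_matrix_def)
next
  case (Cons x xs)
  have app: "jordan_matrix (us @ vs) =
      four_block_mat (jordan_matrix us) (0\<^sub>m (sum_list (map fst us)) (sum_list (map fst vs)))
        (0\<^sub>m (sum_list (map fst vs)) (sum_list (map fst us))) (jordan_matrix vs)"
    for us vs :: "(nat \<times> 'a) list"
    using jordan_matrix_dim[of us] jordan_matrix_dim[of vs]
    unfolding jordan_matrix_def map_append diag_block_mat_append Let_def by simp
  have "x \<in> set ys"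
    using Cons.prems by (metis list.set_intros(1) set_mset_mset)
  then obtain us vs where ys: "ys = us @ x # vs"
    by (meson split_list)
  have "mset xs = mset (vs @ us)"
    using Cons.prems ys by simp
  then have IH: "similar_mat (jordan_matrix xs) (jordan_matrix (vs @ us))"
    by (rule Cons.IH)
  have len: "sum_list (map fst xs) = sum_list (map fst (vs @ us))"
    using \<open>mset xs = mset (vs @ us)\<close> by (metis mset_map sum_mset_sum_list)
  have "similar_mat (jordan_matrix ([x] @ xs)) (jordan_matrix ([x] @ (vs @ us)))"
    unfolding app[of "[x]"] len
    by (rule similar_mat_four_block_0_0[OF similar_mat_refl[OF jordan_matrix_carrier] IH
          jordan_matrix_carrier jordan_matrix_carrier[of xs, unfolded len]])
  moreover have "similar_mat (jordan_matrix ((x # vs) @ us)) (jordan_matrix (us @ x # vs))"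
    unfolding app by (rule similar_four_block_swap) (rule jordan_matrix_carrier)+
  ultimately show ?case
    unfolding ys using similar_mat_trans by fastforce
qed

lemma ex1_jordan_partition: "\<exists>!\<nu>. is_jordan_partition TYPE('a::field) r s \<nu>"
proof -
  let ?K = "kronecker_mat (jordan_block r (1::'a)) (jordan_block s 1)"
  let ?J = "\<lambda>\<nu>. map (\<lambda>m. (m, 1::'a)) \<nu>"
  have K: "?K \<in> carrier_mat (r * s) (r * s)"
    unfolding kronecker_mat_def by simp
  have bnd: "i div s < r" "i mod s < s" if "i < r * s" for i
    using that by (auto simp: less_mult_imp_div_less intro!: mod_less_divisor gr0I)
  have entry: "?K $$ (i, j) = jordan_block r 1 $$ (i div s, j div s) * jordan_block s 1 $$ (i mod s, j mod s)"
    if "i < r * s" "j < r * s" for i j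
    using that unfolding kronecker_mat_def by simp
  have ut: "upper_triangular ?K"
  proof (rule upper_triangularI)
    fix i j assume ij: "j < i" "i < dim_row ?K"
    then have i: "i < r * s" and j: "j < r * s" using K by auto
    have "j div s \<le> i div s" using ij by (simp add: div_le_mono)
    moreover have "j mod s < i mod s" if "j div s = i div s"
      using ij that by (metis div_mult_mod_eq nat_add_left_cancel_less)
    ultimately show "?K $$ (i, j) = 0"
      unfolding entry[OF i j] using bnd[OF i] bnd[OF j] by auto
  qed
  have diag: "?K $$ (i, i) = 1" if "i < r * s" for i
    unfolding entry[OF that that] using bnd[OF that] by simp
  define nas where "nas = triangular_to_jnf_vector ?K"
  have jnf: "jordan_nf ?K nas"
    unfolding nas_def by (rule triangular_to_jnf_vector[OF K ut])
  have "char_poly ?K = (\<Prod>a\<leftarrow>diag_mat ?K. [:- a, 1:])"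
    by (rule char_poly_upper_triangular[OF K ut])
  also have "diag_mat ?K = replicate (r * s) 1"
    using K diag by (auto simp: diag_mat_def intro!: nth_equalityI)
  finally have cp: "char_poly ?K = [:- 1, 1:] ^ (r * s)"
    by (simp add: prod_list_replicate)
  have ev: "a = 1" if mem: "(n, a) \<in> set nas" for n a
  proof -
    have "n \<noteq> 0" using jnf mem unfolding jordan_nf_def by force
    moreover have "n \<le> Polynomial.order a (char_poly ?K)"
      by (rule jordan_nf_block_size_order_bound[OF jnf mem])
    ultimately have "Polynomial.order a (char_poly ?K) \<noteq> 0" by simp
    then show "a = 1"
      unfolding cp by (simp add: order_linear_power split: if_splits)
  qed
  define \<mu> where "\<mu> = rev (sort (map fst nas))"
  have "mset (?J \<mu>) = mset (map (\<lambda>x. (fst x, 1)) nas)"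
    unfolding \<mu>_def by (simp add: multiset.map_comp comp_def)
  also have "map (\<lambda>x. (fst x, 1)) nas = nas"
    using ev by (intro map_idI) auto
  finally have ms: "mset (?J \<mu>) = mset nas" .
  have ex: "is_jordan_partition TYPE('a) r s \<mu>"
    unfolding is_jordan_partition_def
  proof
    show "sorted_wrt (\<ge>) \<mu>"
      unfolding \<mu>_def by (simp add: sorted_wrt_rev)
    have "fst ` set (?J \<mu>) = fst ` set nas"
      using ms by (metis set_mset_mset)
    then show "jordan_nf ?K (?J \<mu>)"
      using jnf similar_mat_trans similar_jordan_matrix_perm[OF ms[symmetric]]
      unfolding jordan_nf_def by metis
  qed
  have uniq: "xs = ys"
    if xs: "is_jordan_partition TYPE('a) r s xs" and ys: "is_jordan_partition TYPE('a) r s ys" for xs ys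
  proof -
    have cnt: "count_list zs k = (if k = 0 then 0 else compute_nr_of_jordan_blocks ?K 1 k)"
      if "is_jordan_partition TYPE('a) r s zs" for zs k
    proof -
      have j: "jordan_nf ?K (?J zs)" using that by (simp add: is_jordan_partition_def)
      have "count_list zs k = length (filter ((=) (k, 1)) (?J zs))"
        by (induction zs) auto
      moreover have "count_list zs 0 = 0"
        using j unfolding jordan_nf_def by (force simp: count_list_0_iff)
      ultimately show ?thesis
        using compute_nr_of_jordan_blocks[OF j, of k 1] by auto
    qed
    have "count (mset xs) = count (mset ys)"
      using cnt[OF xs] cnt[OF ys] by (auto simp: count_mset count_list_eq_length_filter)
    then have "mset (rev xs) = mset (rev ys)"
      by (simp add: multiset_eq_iff)
    moreover have "sorted (rev xs)" "sorted (rev ys)"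
      using xs ys by (simp_all add: is_jordan_partition_def sorted_wrt_rev)
    ultimately have "rev xs = rev ys"
      by (metis properties_for_sort)
    then show ?thesis by simp
  qed
  show ?thesis using ex uniq by blast
qed

lemma is_jordan_partition_jordan_partition:
  "is_jordan_partition TYPE('a::field) r s (jordan_partition TYPE('a) r s)"
  unfolding jordan_partition_def by (rule theI'[OF ex1_jordan_partition])

end

theory Submission
  imports Defs
begin

text \<open>
  Let \<open>J\<^sub>r - 1\<close> and \<open>J\<^sub>s - 1\<close> act as multiplication by \<open>X\<close> and \<open>Y\<close> on \<open>F[X,Y]/(X\<^sup>r, Y\<^sup>s)\<close>.  Then
  \<open>J\<^sub>r \<otimes> J\<^sub>s - 1\<close> acts as \<open>X + Y + X Y = X + Y (1 + X)\<close>, and the substitution \<open>x = X\<close>, \<open>y = Y (1 + X)\<close>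
  preserves the ideal.  So the Jordan partition records how the graded ring \<open>A = F[x,y]/(x\<^sup>r, y\<^sup>s)\<close> splits into
  strings under multiplication by \<open>z = x + y\<close>.

  For \<open>0 < k \<le> r\<close> the power \<open>z\<^sup>r\<^sup>+\<^sup>s\<^sup>-\<^sup>2\<^sup>k\<close> maps the \<open>k\<close>-dimensional component of degree \<open>k-1\<close> to the one of
  degree \<open>r+s-k-1\<close>.  Call \<open>k\<close> a Lefschetz index if this map is bijective, or if \<open>k = 0\<close>.  If \<open>k0 < k1\<close> are
  consecutive Lefschetz indices, then each degree from \<open>k0\<close> to \<open>k1-1\<close> is the bottom of exactly one string, of
  length \<open>r+s-k0-k1\<close> (\<open>jordan_partition_eq_string_lengths\<close>).  The generator in degree \<open>k0\<close> comes from a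
  comparison of syzygies (\<open>kernel_descent\<close>), the others are its multiples by powers of \<open>x\<close>
  (\<open>string_shift_nonzero\<close>).  Thus the composition consists of the differences of consecutive Lefschetz
  indices, and it determines the set of these indices.

  The determinant of the map at \<open>k\<close> is MacMahon's number of plane partitions in a box with sides
  \<open>a = r-k\<close>, \<open>b = s-k\<close> and \<open>k\<close> (\<open>det_shifted_binomial_mat\<close>).  Its \<open>p\<close>-adic valuation is a sum of nonnegative
  contributions, one for each power \<open>Q\<close> of \<open>p\<close>.  The contribution of \<open>Q\<close> depends only on the residues of
  \<open>a\<close>, \<open>b\<close>, \<open>k\<close> modulo \<open>Q\<close>, and it vanishes exactly if one of them is \<open>0\<close> or their sum does not lie strictly
  between \<open>Q\<close> and \<open>2 Q\<close> (\<open>box_defect_zero_iff\<close>).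

  With \<open>q = p\<^sup>n\<^sup>-\<^sup>1\<close>, a shift of \<open>s\<close> by \<open>q\<close> leaves the residues modulo all powers up to \<open>q\<close> unchanged.  In the
  range of the first claim the larger powers never change the outcome (\<open>carry_free_periodic\<close>), so the
  Lefschetz sets agree.  Right after the end of this range, the index \<open>k = r - (\<lceil>r/q\<rceil> - 1) q\<close> stops being a
  Lefschetz index under the shift (\<open>carry_free_breaks\<close>), and the compositions differ.
\<close>

section \<open>MacMahon determinants of binomial coefficients\<close>

text \<open>Vandermonde's convolution, cut off at any \<open>k > j\<close>: the form in which it appears as an entry of a
  product of \<open>k \<times> k\<close> matrices.\<close>
lemma truncated_vandermonde:
  fixes N n j k :: nat
  assumes "j < k"
  shows "(\<Sum>i<k. (if i \<le> n then N choose (n - i) else 0) * (j choose i)) = (N + j) choose n"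
proof -
  let ?t = "\<lambda>i. (if i \<le> n then N choose (n - i) else 0) * (j choose i)"
  have "(\<Sum>i<k. ?t i) = (\<Sum>i<k + Suc n. ?t i)"
    using assms by (intro sum.mono_neutral_left) (auto simp: binomial_eq_0)
  also have "\<dots> = (\<Sum>i\<le>n. (j choose i) * (N choose (n - i)))"
    by (intro sum.mono_neutral_cong_right) (auto simp: mult.commute)
  also have "\<dots> = (N + j) choose n"
    using vandermonde[of j N n] by (simp add: add.commute)
  finally show ?thesis .
qed

lemma binomial_fact_swap:
  fixes a b j l :: nat
  shows "((a + b + j) choose (a + l)) * fact (a + l) * fact (b + j) =
    fact l * ((b + j) choose l) * (fact (a + b + j) :: nat)"
proof (cases "l \<le> b + j")
  case True
  have "fact (a + l) * fact (b + j - l) * ((a + b + j) choose (a + l)) = (fact (a + b + j) :: nat)"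
    using binomial_fact_lemma[of "a + l" "a + b + j"] True by (simp add: add.assoc)
  moreover have "fact l * fact (b + j - l) * ((b + j) choose l) = (fact (b + j) :: nat)"
    using binomial_fact_lemma[OF True] .
  moreover have "c * x * y = z * d * w" if "x * g * c = w" "z * g * d = y" for c d g w x y z :: nat
    unfolding that[symmetric] by (simp only: mult_ac)
  ultimately show ?thesis by blast
qed (simp add: binomial_eq_0)

text \<open>This is the matrix of multiplication by \<open>(x+y)\<^sup>a\<^sup>+\<^sup>b\<close> from the forms of degree \<open>k-1\<close> to those of degree
  \<open>a+b+k-1\<close>, taken modulo \<open>(x\<^sup>a\<^sup>+\<^sup>k, y\<^sup>b\<^sup>+\<^sup>k)\<close>, in the monomial bases.\<close>
definition shifted_binomial_mat :: "nat \<Rightarrow> nat \<Rightarrow> nat \<Rightarrow> int mat" where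
  "shifted_binomial_mat a b k =
     mat k k (\<lambda>(l, i). int (if i \<le> a + l then (a + b) choose (a + l - i) else 0))"

lemma det_diagonal:
  fixes f :: "nat \<Rightarrow> 'a::comm_ring_1"
  shows "det (mat n n (\<lambda>(i, j). if i = j then f i else 0)) = (\<Prod>i<n. f i)"
  by (subst det_upper_triangular[of _ n])
     (auto simp: prod_list_diag_prod lessThan_atLeast0)

lemma mat_mult_entry:
  fixes f g :: "nat \<Rightarrow> nat \<Rightarrow> 'a::comm_ring_1"
  shows "mat n n (\<lambda>(i, j). f i j) * mat n n (\<lambda>(i, j). g i j) =
    mat n n (\<lambda>(i, j). \<Sum>t<n. f i t * g t j)"
  by (rule eq_matI) (auto simp: scalar_prod_def lessThan_atLeast0)

text \<open>MacMahon's product for the number of plane partitions in an \<open>a \<times> b \<times> k\<close> box.  Multiplying by the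
  unitriangular matrix \<open>U\<close> of binomial coefficients turns the entry in column \<open>j\<close> into
  \<open>(a+b+j) choose (a+l)\<close>.  Pulling factorials out of the rows and columns leaves \<open>(b+j) choose l\<close>,
  which is again a product of two unitriangular matrices by Vandermonde's convolution.\<close>
lemma det_shifted_binomial_mat:
  "det (shifted_binomial_mat a b k) * (\<Prod>i<k. fact (a + i) * fact (b + i)) =
     (\<Prod>i<k. fact (a + b + i) * fact i)"
proof -
  define U where "U = mat k k (\<lambda>(i, j). int (j choose i))"
  define V where "V = mat k k (\<lambda>(l, i). int (if i \<le> l then b choose (l - i) else 0))"
  define C where "C = mat k k (\<lambda>(l, j). int ((a + b + j) choose (a + l)))"
  define B where "B = mat k k (\<lambda>(l, j). int ((b + j) choose l))"
  define diag where "diag f = mat k k (\<lambda>(i, j). if i = j then f i else 0)" for f :: "nat \<Rightarrow> int"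
  have car: "U \<in> carrier_mat k k" "V \<in> carrier_mat k k" "C \<in> carrier_mat k k"
    "B \<in> carrier_mat k k" "diag f \<in> carrier_mat k k" "shifted_binomial_mat a b k \<in> carrier_mat k k"
    for f by (auto simp: U_def V_def C_def B_def diag_def shifted_binomial_mat_def)
  have U: "det U = 1"
    by (subst det_upper_triangular[OF _ car(1)])
       (auto simp: U_def prod_list_diag_prod binomial_eq_0)
  have V: "det V = 1"
    by (subst det_lower_triangular[OF _ car(2)])
       (auto simp: V_def prod_list_diag_prod)
  have MU: "shifted_binomial_mat a b k * U = C"
    unfolding shifted_binomial_mat_def U_def C_def mat_mult_entry
    by (rule cong_mat)
       (auto simp flip: of_nat_mult of_nat_sum simp: truncated_vandermonde[of _ k "a + _" "a + b"])
  have VU: "V * U = B"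
    unfolding V_def U_def B_def mat_mult_entry
    by (rule cong_mat)
       (auto simp flip: of_nat_mult of_nat_sum simp: truncated_vandermonde[of _ k _ b])
  have dl: "diag f * mat k k (\<lambda>(i, j). g i j) = mat k k (\<lambda>(i, j). f i * g i j)" for f g
    unfolding diag_def mat_mult_entry
    by (rule cong_mat) (auto simp: if_distrib[of "\<lambda>x. x * _"] cong: if_cong)
  have dr: "mat k k (\<lambda>(i, j). g i j) * diag f = mat k k (\<lambda>(i, j). g i j * f j)" for f g
    unfolding diag_def mat_mult_entry
    by (rule cong_mat) (auto simp: if_distrib[of "\<lambda>x. _ * x"] cong: if_cong)
  have eq: "diag (\<lambda>l. fact (a + l)) * C * diag (\<lambda>j. fact (b + j)) =
      diag fact * B * diag (\<lambda>j. fact (a + b + j))"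
    unfolding C_def B_def dl dr
  proof (rule cong_mat, simp_all)
    fix l j
    have "int (((a + b + j) choose (a + l)) * fact (a + l) * fact (b + j)) =
       int (fact l * ((b + j) choose l) * fact (a + b + j))"
      by (simp only: binomial_fact_swap)
    then show "fact (a + l) * int ((a + b + j) choose (a + l)) * fact (b + j) =
       fact l * int ((b + j) choose l) * fact (a + b + j)"
      by (simp add: mult_ac)
  qed
  have det3: "det (X * Y * Z) = det X * det Y * det Z"
    if "X \<in> carrier_mat k k" "Y \<in> carrier_mat k k" "Z \<in> carrier_mat k k" for X Y Z :: "int mat"
    using that by (metis det_mult mult_carrier_mat)
  have det_diag: "det (diag f) = (\<Prod>i<k. f i)" for f
    unfolding diag_def by (rule det_diagonal)
  have dC: "det (shifted_binomial_mat a b k) = det C"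
    using det_mult[OF car(6) car(1)] MU U by simp
  have dB: "det B = 1"
    using det_mult[OF car(2) car(1)] VU U V by simp
  have "(\<Prod>i<k. fact (a + i)) * det C * (\<Prod>i<k. fact (b + i)) =
      det (diag (\<lambda>l. fact (a + l)) * C * diag (\<lambda>j. fact (b + j)))"
    by (simp only: det3[OF car(5) car(3) car(5)] det_diag)
  also have "\<dots> = (\<Prod>i<k. fact i) * (\<Prod>i<k. fact (a + b + i))"
    by (simp only: eq det3[OF car(5) car(4) car(5)] det_diag dB mult_1_right)
  finally have "(\<Prod>i<k. fact (a + i)) * det C * (\<Prod>i<k. fact (b + i)) =
    (\<Prod>i<k. fact i) * (\<Prod>i<k. fact (a + b + i))" .
  moreover have "x * (f1 * f2) = f4 * f3" if "f1 * x * f2 = f3 * f4" for x f1 f2 f3 f4 :: int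
    using that by (simp add: mult_ac)
  ultimately show ?thesis
    unfolding prod.distrib dC by blast
qed

section \<open>Primes dividing the MacMahon determinant\<close>

lemma multiplicity_eq_sum_dvd:
  fixes p n E :: nat
  assumes p: "prime p" and n: "0 < n" "n < p ^ E"
  shows "multiplicity p n = (\<Sum>e=1..E. of_bool (p ^ e dvd n))"
proof -
  have np: "\<not> is_unit p" "n \<noteq> 0" using p n by auto
  have le: "multiplicity p n \<le> E"
  proof -
    have "p ^ multiplicity p n \<le> n" using n by (simp add: multiplicity_dvd dvd_imp_le)
    then have "p ^ multiplicity p n < p ^ E" using n by simp
    then show ?thesis using prime_gt_1_nat[OF p] by simp
  qed
  have "(\<Sum>e=1..E. of_bool (p ^ e dvd n)) = card ({1..E} \<inter> {e. p ^ e dvd n})"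
    by simp
  also have "{1..E} \<inter> {e. p ^ e dvd n} = {1..multiplicity p n}"
    using le np by (auto simp: power_dvd_iff_le_multiplicity)
  finally show ?thesis by simp
qed

text \<open>Legendre's formula, with the sum over exponents cut off at any bound beyond which all
  terms vanish.\<close>
lemma multiplicity_fact:
  fixes p n E :: nat
  assumes p: "prime p" and n: "n < p ^ E"
  shows "multiplicity p (fact n :: nat) = (\<Sum>e=1..E. n div p ^ e)"
  using n
proof (induction n)
  case (Suc n)
  have "multiplicity p (fact (Suc n) :: nat) = multiplicity p (Suc n) + multiplicity p (fact n :: nat)"
    unfolding fact_Suc using p by (subst of_nat_id, subst prime_elem_multiplicity_mult_distrib) auto
  also have "\<dots> = (\<Sum>e=1..E. of_bool (p ^ e dvd Suc n) + n div p ^ e)"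
    using Suc multiplicity_eq_sum_dvd[OF p, of "Suc n" E] by (simp add: sum.distrib)
  also have "\<dots> = (\<Sum>e=1..E. Suc n div p ^ e)"
    by (rule sum.cong) (auto simp: div_Suc dvd_eq_mod_eq_0)
  finally show ?case .
qed auto

text \<open>The sum of the floors \<open>i div Q\<close> over \<open>i < x\<close>: the contribution of the prime power \<open>Q\<close> to
  the valuation of the superfactorial \<open>0! 1! \<cdots> (x-1)!\<close>.\<close>
definition floor_sum :: "nat \<Rightarrow> nat \<Rightarrow> int" where
  "floor_sum Q x = int (\<Sum>i<x. i div Q)"

lemma floor_sum_add_period:
  assumes "0 < Q"
  shows "floor_sum Q (x + Q) = floor_sum Q x + int x"
proof (induction x)
  case 0
  have "(\<Sum>i<Q. i div Q) = 0" by simp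
  then show ?case unfolding floor_sum_def by simp
next
  case (Suc x)
  then show ?case using assms by (simp add: floor_sum_def)
qed

lemma floor_sum_first_period: "x \<le> Q \<Longrightarrow> floor_sum Q x = 0"
  by (simp add: floor_sum_def)

lemma floor_sum_second_period:
  assumes "Q \<le> x" "x \<le> 2 * Q" "0 < Q"
  shows "floor_sum Q x = int x - int Q"
  using floor_sum_add_period[OF assms(3), of "x - Q"] floor_sum_first_period[of "x - Q" Q] assms
  by simp

lemma floor_sum_third_period:
  assumes "2 * Q \<le> x" "x \<le> 3 * Q" "0 < Q"
  shows "floor_sum Q x = 2 * int x - 3 * int Q"
  using floor_sum_add_period[OF assms(3), of "x - Q"] floor_sum_second_period[of Q "x - Q"] assms
  by simp

text \<open>The contribution of the prime power \<open>Q\<close> to the valuation of MacMahon's product.\<close>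
definition box_defect :: "nat \<Rightarrow> nat \<Rightarrow> nat \<Rightarrow> nat \<Rightarrow> int" where
  "box_defect Q a b k = floor_sum Q (a + b + k) + floor_sum Q a + floor_sum Q b + floor_sum Q k
     - floor_sum Q (a + b) - floor_sum Q (a + k) - floor_sum Q (b + k)"

text \<open>Adding \<open>Q\<close> to the argument raises \<open>floor_sum Q\<close> by that argument, and the linear terms produced by
  the four sums that contain \<open>a\<close> cancel.  Hence only the residues modulo \<open>Q\<close> matter.\<close>
lemma box_defect_add_period:
  assumes "0 < Q"
  shows "box_defect Q (a + Q) b k = box_defect Q a b k"
proof -
  have "a + Q + b + k = (a + b + k) + Q" "a + Q + b = (a + b) + Q" "a + Q + k = (a + k) + Q" by auto
  then show ?thesis unfolding box_defect_def by (simp only: floor_sum_add_period[OF assms])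
qed

lemma box_defect_commute:
  "box_defect Q a b k = box_defect Q b a k" "box_defect Q a b k = box_defect Q k b a"
  unfolding box_defect_def by (simp_all add: add_ac)

lemma box_defect_mod_left:
  assumes "0 < Q"
  shows "box_defect Q a b k = box_defect Q (a mod Q) b k"
proof -
  have "box_defect Q (x + u * Q) b k = box_defect Q x b k" for x u
  proof (induction u)
    case (Suc u)
    show ?case using box_defect_add_period[OF assms, of "x + u * Q" b k] Suc by (simp add: add_ac)
  qed auto
  from this[of "a mod Q" "a div Q"] show ?thesis by simp
qed

lemma box_defect_mod:
  assumes "0 < Q"
  shows "box_defect Q a b k = box_defect Q (a mod Q) (b mod Q) (k mod Q)"
  using box_defect_mod_left[OF assms] box_defect_commute by metis

definition box_carry_free :: "nat \<Rightarrow> nat \<Rightarrow> nat \<Rightarrow> nat \<Rightarrow> bool" where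
  "box_carry_free Q a b k \<longleftrightarrow> a mod Q = 0 \<or> b mod Q = 0 \<or> k mod Q = 0 \<or>
     a mod Q + b mod Q + k mod Q \<le> Q \<or> 2 * Q \<le> a mod Q + b mod Q + k mod Q"

text \<open>For residues \<open>a, b, k < Q\<close> every floor sum involved is linear on each of the intervals between
  consecutive multiples of \<open>Q\<close>, so that a comparison of linear functions remains.\<close>
lemma box_defect_zero_iff:
  assumes Q: "0 < Q"
  shows "0 \<le> box_defect Q a b k \<and> (box_defect Q a b k = 0 \<longleftrightarrow> box_carry_free Q a b k)"
proof -
  have main: "0 \<le> box_defect Q a b k \<and> (box_defect Q a b k = 0 \<longleftrightarrow> a = 0 \<or> b = 0 \<or> k = 0 \<or>
      a + b + k \<le> Q \<or> 2 * Q \<le> a + b + k)" if lt: "a < Q" "b < Q" "k < Q" for a b k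
  proof -
    have two: "floor_sum Q (x + y) = max 0 (int (x + y) - int Q)" if "x < Q" "y < Q" for x y
      using that floor_sum_first_period[of "x + y" Q] floor_sum_second_period[of Q "x + y"]
      by (cases "x + y \<le> Q") auto
    have one: "floor_sum Q x = 0" if "x < Q" for x
      using that floor_sum_first_period[of x Q] by simp
    consider "a + b + k \<le> Q" | "Q < a + b + k" "a + b + k < 2 * Q" | "2 * Q \<le> a + b + k"
      by linarith
    then show ?thesis
    proof cases
      case 1
      then show ?thesis using lt unfolding box_defect_def
        by (simp add: two one floor_sum_first_period)
    next
      case 2
      then have "floor_sum Q (a + b + k) = int (a + b + k) - int Q"
        using Q by (intro floor_sum_second_period) auto
      then show ?thesis using 2 lt unfolding box_defect_def
        by (simp add: two one max_def)
    next
      case 3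
      then have "floor_sum Q (a + b + k) = 2 * int (a + b + k) - 3 * int Q"
        using Q lt by (intro floor_sum_third_period) auto
      then show ?thesis using 3 lt unfolding box_defect_def
        by (simp add: two one max_def)
    qed
  qed
  show ?thesis
    unfolding box_carry_free_def box_defect_mod[OF Q, of a b k]
    using Q by (intro main) auto
qed

lemma multiplicity_prod_fact:
  assumes p: "prime p" and "c + k \<le> p ^ E"
  shows "int (multiplicity p (\<Prod>i<k. fact (c + i) :: nat)) =
    (\<Sum>e=1..E. floor_sum (p ^ e) (c + k) - floor_sum (p ^ e) c)"
proof -
  have "multiplicity p (\<Prod>i<k. fact (c + i) :: nat) = (\<Sum>i<k. multiplicity p (fact (c + i) :: nat))"
    using p by (intro prime_elem_multiplicity_prod_distrib) auto
  also have "\<dots> = (\<Sum>i<k. \<Sum>e=1..E. (c + i) div p ^ e)"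
    using assms by (intro sum.cong refl multiplicity_fact) auto
  also have "\<dots> = (\<Sum>e=1..E. \<Sum>i<k. (c + i) div p ^ e)" by (rule sum.swap)
  also have "int \<dots> = (\<Sum>e=1..E. floor_sum (p ^ e) (c + k) - floor_sum (p ^ e) c)"
    unfolding of_nat_sum[of _ "{1..E}"]
  proof (rule sum.cong[OF refl])
    fix e
    have "floor_sum Q (c + k) = floor_sum Q c + int (\<Sum>i<k. (c + i) div Q)" for Q
      unfolding floor_sum_def by (induction k) simp_all
    then show "int (\<Sum>i<k. (c + i) div p ^ e) = floor_sum (p ^ e) (c + k) - floor_sum (p ^ e) c"
      by simp
  qed
  finally show ?thesis .
qed

text \<open>The valuation of the determinant is the sum of the contributions of all powers of \<open>p\<close>.  None of
  them is negative, so the sum vanishes only if each of them does.\<close>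
lemma prime_dvd_det_shifted_binomial_mat_iff:
  assumes p: "prime p"
  shows "int p dvd det (shifted_binomial_mat a b k) \<longleftrightarrow>
    (\<exists>e\<ge>1. \<not> box_carry_free (p ^ e) a b k)"
proof -
  define N where "N = nat \<bar>det (shifted_binomial_mat a b k)\<bar>"
  define E where "E = a + b + k"
  have big: "E < p ^ E" using prime_gt_1_nat[OF p] less_exp[of E] power_mono[of 2 p E]
    by (meson Suc_leI le_less_trans less_le_trans le0 numeral_2_eq_2 order_less_le_trans
        prime_ge_2_nat[OF p])
  have "int (N * (\<Prod>i<k. fact (a + i) * fact (b + i))) =
      \<bar>det (shifted_binomial_mat a b k) * (\<Prod>i<k. fact (a + i) * fact (b + i))\<bar>"
    by (simp add: N_def abs_mult abs_prod)
  also have "\<dots> = int (\<Prod>i<k. fact (a + b + i) * fact i)"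
    unfolding det_shifted_binomial_mat by (simp add: abs_mult abs_prod)
  finally have eq: "N * ((\<Prod>i<k. fact (a + i)) * (\<Prod>i<k. fact (b + i))) =
      (\<Prod>i<k. fact (a + b + i)) * (\<Prod>i<k. fact (0 + i))"
    unfolding of_nat_eq_iff by (simp add: prod.distrib)
  have nz: "(\<Prod>i<k. fact (c + i) :: nat) \<noteq> 0" for c by simp
  have "N \<noteq> 0"
    using eq nz[of "a + b"] nz[of 0] by (metis mult_eq_0_iff)
  have "int (multiplicity p N) + int (multiplicity p (\<Prod>i<k. fact (a + i) :: nat)) +
      int (multiplicity p (\<Prod>i<k. fact (b + i) :: nat)) =
      int (multiplicity p (N * ((\<Prod>i<k. fact (a + i)) * (\<Prod>i<k. fact (b + i)))))"
    using \<open>N \<noteq> 0\<close> nz p by (simp add: prime_elem_multiplicity_mult_distrib del: fact_prod)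
  also have "\<dots> = int (multiplicity p (\<Prod>i<k. fact (a + b + i) :: nat)) +
      int (multiplicity p (\<Prod>i<k. fact (0 + i) :: nat))"
    unfolding eq using nz p by (subst prime_elem_multiplicity_mult_distrib) auto
  finally have "int (multiplicity p N) = (\<Sum>e=1..E. box_defect (p ^ e) a b k)"
    using p big unfolding E_def
    by (subst (asm) (1 2 3 4) multiplicity_prod_fact[OF p, where E = E])
       (auto simp: E_def box_defect_def sum_subtractf sum.distrib floor_sum_first_period)
  moreover have "(\<Sum>e=1..E. box_defect (p ^ e) a b k) = 0 \<longleftrightarrow>
      (\<forall>e\<in>{1..E}. box_defect (p ^ e) a b k = 0)"
    using box_defect_zero_iff prime_gt_0_nat[OF p] by (intro sum_nonneg_eq_0_iff) auto
  moreover have "p dvd N \<longleftrightarrow> multiplicity p N \<noteq> 0"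
    using p \<open>N \<noteq> 0\<close> by (metis multiplicity_eq_zero_iff not_prime_unit)
  ultimately have "p dvd N \<longleftrightarrow> (\<exists>e\<in>{1..E}. \<not> box_carry_free (p ^ e) a b k)"
    using box_defect_zero_iff prime_gt_0_nat[OF p] by auto
  moreover have "box_carry_free (p ^ e) a b k" if "E < e" for e
  proof -
    have "E < p ^ e"
      using big that power_increasing[of E e p] prime_gt_0_nat[OF p] by linarith
    then show ?thesis unfolding box_carry_free_def E_def by simp
  qed
  ultimately have "p dvd N \<longleftrightarrow> (\<exists>e\<ge>1. \<not> box_carry_free (p ^ e) a b k)"
    by (metis atLeastAtMost_iff not_le)
  moreover have "int p dvd det (shifted_binomial_mat a b k) \<longleftrightarrow> p dvd N"
    unfolding N_def by (metis dvd_abs_iff int_dvd_int_iff int_nat_eq abs_ge_zero)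
  ultimately show ?thesis by simp
qed

section \<open>Binary forms modulo powers of the variables\<close>

text \<open>A polynomial \<open>g\<close> of degree at most \<open>D\<close> stands for the form \<open>y\<^sup>D g(x/y)\<close> of degree \<open>D\<close>, whose monomials
  are the \<open>x\<^sup>l y\<^sup>D\<^sup>-\<^sup>l\<close>.  The condition says that this form lies in the ideal \<open>(x\<^sup>r, y\<^sup>s)\<close>.\<close>
definition in_box_ideal :: "nat \<Rightarrow> nat \<Rightarrow> nat \<Rightarrow> 'a::zero poly \<Rightarrow> bool" where
  "in_box_ideal r s D g \<longleftrightarrow> (\<forall>l\<le>D. l < r \<longrightarrow> D - l < s \<longrightarrow> coeff g l = 0)"

text \<open>The linear form \<open>z = x + y\<close> in this dehomogenised notation.\<close>
abbreviation (input) zform :: "'a::field poly" where "zform \<equiv> [:1, 1:]"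

text \<open>Multiplication by \<open>z\<^sup>m\<close> is not injective on the forms of degree \<open>d\<close> modulo \<open>(x\<^sup>r, y\<^sup>s)\<close>; this reading is
  valid for \<open>d < r\<close> and \<open>d < s\<close>, where no nonzero form of degree \<open>d\<close> lies in the ideal.\<close>
definition has_kernel :: "'a::field itself \<Rightarrow> nat \<Rightarrow> nat \<Rightarrow> nat \<Rightarrow> nat \<Rightarrow> bool" where
  "has_kernel F r s d m \<longleftrightarrow>
     (\<exists>f::'a poly. f \<noteq> 0 \<and> degree f \<le> d \<and> in_box_ideal r s (d + m) (zform ^ m * f))"

text \<open>For \<open>0 < k \<le> r \<le> s\<close> the degrees \<open>k-1\<close> and \<open>r+s-k-1\<close> are symmetric about the middle of the quotient
  ring, and their components have the same dimension \<open>k\<close>.  A Lefschetz index is one at which the power of \<open>z\<close> between them is bijective.\<close>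
definition lefschetz :: "'a::field itself \<Rightarrow> nat \<Rightarrow> nat \<Rightarrow> nat \<Rightarrow> bool" where
  "lefschetz F r s k \<longleftrightarrow> k = 0 \<or> \<not> has_kernel F r s (k - 1) (r + s - 2 * k)"

lemma coeff_zform_mult: "coeff (zform * g) l = coeff g l + (if l = 0 then 0 else coeff g (l - 1))"
  by (cases l) auto

lemma coeff_zform_power: "coeff (zform ^ m :: 'a::field poly) i = of_nat (m choose i)"
proof (induction m arbitrary: i)
  case (Suc m)
  show ?case unfolding power_Suc coeff_zform_mult Suc by (cases i) (auto simp: add.commute)
next
  case 0
  show ?case by (cases i) (auto simp: coeff_1)
qed

lemma degree_zform_power_mult:
  "f \<noteq> 0 \<Longrightarrow> degree (zform ^ m * f :: 'a::field poly) = m + degree f"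
  by (simp add: degree_mult_eq degree_power_eq)

lemma degree_zform_power_mult_le:
  "degree f \<le> d \<Longrightarrow> degree (zform ^ m * f :: 'a::field poly) \<le> d + m"
  by (cases "f = 0") (auto simp: degree_zform_power_mult)

lemma in_box_ideal_monom_mult:
  "in_box_ideal r s D g \<Longrightarrow> in_box_ideal r s (D + i) (monom (1::'a::field) i * g)"
  unfolding in_box_ideal_def coeff_monom_mult by auto

lemma in_box_ideal_zform_mult:
  "in_box_ideal r s D g \<Longrightarrow> degree g \<le> D \<Longrightarrow> in_box_ideal r s (Suc D) (zform * g :: 'a::field poly)"
  unfolding in_box_ideal_def coeff_zform_mult
proof (intro allI impI)
  fix l assume *: "\<forall>l\<le>D. l < r \<longrightarrow> D - l < s \<longrightarrow> coeff g l = 0" "degree g \<le> D"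
    "l \<le> Suc D" "l < r" "Suc D - l < s"
  have "coeff g l = 0" using * by (cases "l = Suc D") (auto intro: coeff_eq_0)
  moreover have "coeff g (l - 1) = 0" if "0 < l" using * that by auto
  ultimately show "coeff g l + (if l = 0 then 0 else coeff g (l - 1)) = 0" by auto
qed

lemma has_kernel_Suc:
  "has_kernel TYPE('a::field) r s d m \<Longrightarrow> has_kernel TYPE('a) r s d (Suc m)"
  unfolding has_kernel_def
proof (elim exE conjE)
  fix f :: "'a poly"
  assume f: "f \<noteq> 0" "degree f \<le> d" "in_box_ideal r s (d + m) (zform ^ m * f)"
  have "in_box_ideal r s (Suc (d + m)) (zform * (zform ^ m * f))"
    using f(3) degree_zform_power_mult_le[OF f(2)] by (rule in_box_ideal_zform_mult)
  moreover have "zform * (zform ^ m * f) = zform ^ Suc m * f" by (simp only: power_Suc mult.assoc)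
  ultimately show "\<exists>f::'a poly. f \<noteq> 0 \<and> degree f \<le> d \<and> in_box_ideal r s (d + Suc m) (zform ^ Suc m * f)"
    using f by (intro exI[of _ f]) auto
qed

text \<open>A kernel element may absorb some of the factors \<open>z\<close>; its image then stays the same.\<close>
lemma has_kernel_trade:
  "has_kernel TYPE('a::field) r s d (m + j) \<Longrightarrow> has_kernel TYPE('a) r s (d + j) m"
  unfolding has_kernel_def
proof (elim exE conjE)
  fix f :: "'a poly"
  assume "f \<noteq> 0" "degree f \<le> d" "in_box_ideal r s (d + (m + j)) (zform ^ (m + j) * f)"
  moreover have "zform ^ (m + j) * f = zform ^ m * (zform ^ j * f)"
    by (simp only: power_add mult.assoc)
  moreover have "d + (m + j) = d + j + m" by simp
  ultimately show "\<exists>f::'a poly. f \<noteq> 0 \<and> degree f \<le> d + j \<and> in_box_ideal r s (d + j + m) (zform ^ m * f)"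
    using degree_zform_power_mult_le[of f d j] by (intro exI[of _ "zform ^ j * f"]) auto
qed

lemma in_box_ideal_sum:
  fixes u v :: "'a::field poly"
  assumes "v = 0 \<or> degree v + s \<le> D"
  shows "in_box_ideal r s D (monom 1 r * u + v)"
  unfolding in_box_ideal_def using assms by (auto simp: coeff_monom_mult intro: coeff_eq_0)

lemma in_box_idealE:
  fixes g :: "'a::field poly"
  assumes "in_box_ideal r s D g" "degree g \<le> D" "r \<le> D" "s \<le> D"
  obtains u v where "g = monom 1 r * u + v" "degree u \<le> D - r" "degree v \<le> D - s"
proof
  show "g = monom 1 r * poly_shift r g + poly_cutoff r g"
    by (rule poly_eqI) (auto simp: coeff_monom_mult coeff_poly_shift coeff_poly_cutoff)
  show "degree (poly_shift r g) \<le> D - r"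
    using assms by (intro degree_le) (auto simp: coeff_poly_shift intro: coeff_eq_0)
  show "degree (poly_cutoff r g) \<le> D - s"
  proof (intro degree_le allI impI)
    fix l assume "D - s < l"
    then show "coeff (poly_cutoff r g) l = 0"
      using assms unfolding in_box_ideal_def coeff_poly_cutoff
      by (cases "l \<le> D") (auto intro: coeff_eq_0)
  qed
qed

section \<open>Syzygies and generators of strings\<close>

text \<open>The triples proportional to \<open>(w, w1, w2)\<close> form a module of rank one over a principal ideal domain, so
  it is free.  A nonzero triple with first entry of least degree generates it, by division with
  remainder; this replaces dividing \<open>(w, w1, w2)\<close> by a greatest common divisor.\<close>
lemma rank_one_module_generator:
  fixes w w1 w2 :: "'a::field poly"
  assumes w: "w \<noteq> 0"
  obtains g g1 g2 where "g \<noteq> 0"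
    "\<And>u u1 u2. w * u1 = u * w1 \<Longrightarrow> w * u2 = u * w2 \<Longrightarrow>
      \<exists>q. u = q * g \<and> u1 = q * g1 \<and> u2 = q * g2"
proof -
  define P where "P u = (u \<noteq> 0 \<and> (\<exists>u1 u2. w * u1 = u * w1 \<and> w * u2 = u * w2))" for u
  have "P w" unfolding P_def using w by blast
  then obtain g where g: "P g" and min: "\<And>u. P u \<Longrightarrow> degree g \<le> degree u"
    using ex_has_least_nat[of P w degree] by blast
  from g obtain g1 g2 where g0: "g \<noteq> 0" and g12: "w * g1 = g * w1" "w * g2 = g * w2"
    unfolding P_def by blast
  show ?thesis
  proof (rule that[OF g0])
    fix u u1 u2 assume u: "w * u1 = u * w1" "w * u2 = u * w2"
    define q where "q = u div g"
    have md: "u mod g = u - q * g" unfolding q_def by (simp add: minus_div_mult_eq_mod)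
    have "u mod g = 0"
    proof (rule ccontr)
      assume nz: "u mod g \<noteq> 0"
      have "w * (u1 - q * g1) = (u - q * g) * w1" "w * (u2 - q * g2) = (u - q * g) * w2"
        using u g12 by (simp_all add: algebra_simps)
      then have "P (u mod g)" unfolding P_def using nz md by metis
      then have "degree g \<le> degree (u mod g)" by (rule min)
      with nz g0 degree_mod_less[OF g0, of u] show False by linarith
    qed
    then have "u = q * g" using md by simp
    moreover have "w * u1 = w * (q * g1)" "w * u2 = w * (q * g2)"
      using u g12 \<open>u = q * g\<close> by (metis mult.assoc mult.left_commute)+
    ultimately show "\<exists>q. u = q * g \<and> u1 = q * g1 \<and> u2 = q * g2"
      using w by auto
  qed
qed

lemma zform_power_dvd_cancel:
  fixes g c :: "'a::field poly"
  assumes "\<not> zform dvd g" "zform ^ t dvd g * c"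
  shows "zform ^ t dvd c"
proof (cases "c = 0")
  case False
  have z: "zform = [:- (- 1), 1 :: 'a:]" by simp
  have "g \<noteq> 0" using assms(1) by auto
  moreover have "Polynomial.order (- 1) g = 0"
    using assms(1) by (metis dvd_iff_poly_eq_0 order_0I z)
  ultimately show ?thesis
    using assms(2) False unfolding z order_divides by (auto simp: order_mult)
qed auto

text \<open>The step that makes the Lefschetz set determine the whole module.  A kernel element \<open>w\<close> of \<open>z\<^sup>e\<close> and
  one \<open>v\<close> of \<open>z\<^sup>e\<^sup>+\<^sup>t\<close> give two syzygies between \<open>z\<^sup>e\<close>, \<open>x\<^sup>r\<close> and \<open>y\<^sup>s\<close>, namely \<open>(w, w1, w2)\<close> and
  \<open>(v z\<^sup>t, v1, v2)\<close>.  Their cross product is a multiple of \<open>(z\<^sup>e, x\<^sup>r, y\<^sup>s)\<close>, and its component along \<open>z\<^sup>e\<close> has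
  degree at most \<open>e-1\<close>, so it vanishes and the syzygies are proportional.  If the degree of \<open>w\<close> could
  not be lowered at the cost of one more factor \<open>z\<close>, then \<open>w\<close> would itself generate the proportional
  syzygies and be prime to \<open>z\<close>.  It would then divide \<open>v\<close>, of smaller degree, and the degrees of the
  quotients contradict minimality.\<close>
lemma kernel_descent:
  assumes d: "1 \<le> d" "d < k" "k \<le> r" "r \<le> s"
    and ker: "has_kernel TYPE('a::field) r s d (r + s - k - d)"
    and deg: "\<not> lefschetz TYPE('a) r s d"
  shows "has_kernel TYPE('a) r s (d - 1) (r + s - k - d + 1)"
proof (rule ccontr)
  assume contra: "\<not> ?thesis"
  define e t where "e = r + s - k - d" and "t = k - d"
  have contra': "\<not> has_kernel TYPE('a) r s (d - 1) e"
    using contra has_kernel_Suc unfolding e_def by fastforce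
  have no_gen: False if "z ^ e * g = monom 1 r * g1 + g2" "g \<noteq> 0" "degree g \<le> d - 1"
    "g2 = 0 \<or> degree g2 + 1 \<le> r - k" "z = zform" for z g g1 g2 :: "'a poly"
  proof -
    have "in_box_ideal r s (d - 1 + e) (zform ^ e * g)"
      using that d unfolding \<open>z = zform\<close> by (simp only:) (intro in_box_ideal_sum, auto simp: e_def)
    with that contra' show False unfolding has_kernel_def by blast
  qed
  obtain w :: "'a poly" where w: "w \<noteq> 0" "degree w \<le> d" "in_box_ideal r s (d + e) (zform ^ e * w)"
    using ker unfolding has_kernel_def e_def by blast
  have et: "r + s - 2 * d = e + t" "d + e = r + s - k" using d by (auto simp: e_def t_def)
  obtain v :: "'a poly" where v: "v \<noteq> 0" "degree v \<le> d - 1"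
      "in_box_ideal r s (d - 1 + (e + t)) (zform ^ (e + t) * v)"
    using deg d unfolding lefschetz_def has_kernel_def et by auto
  obtain w1 w2 where W: "zform ^ e * w = monom 1 r * w1 + w2"
    "degree w1 \<le> d + e - r" "degree w2 \<le> d + e - s"
    using w(3) degree_zform_power_mult_le[OF w(2)] by (rule in_box_idealE) (use d et in auto)
  obtain v1 v2 where V: "zform ^ (e + t) * v = monom 1 r * v1 + v2"
    "degree v1 \<le> d - 1 + (e + t) - r" "degree v2 \<le> d - 1 + (e + t) - s"
    using v(3) degree_zform_power_mult_le[OF v(2)]
    by (rule in_box_idealE) (use d in \<open>auto simp: e_def t_def\<close>)
  define y :: "'a poly" where "y = v * zform ^ t"
  have V': "zform ^ e * y = monom 1 r * v1 + v2" using V(1) by (simp add: y_def power_add mult_ac)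
  \<comment> \<open>Components of the cross product of the two syzygies.\<close>
  have cross1: "zform ^ e * (w * v1 - y * w1) = w2 * v1 - v2 * w1"
  proof -
    have "zform ^ e * (w * v1 - y * w1) = (zform ^ e * w) * v1 - (zform ^ e * y) * w1"
      by (simp only: right_diff_distrib mult.assoc)
    then show ?thesis unfolding W V' by (simp add: algebra_simps)
  qed
  have cross2: "zform ^ e * (w * v2 - y * w2) = monom 1 r * (w1 * v2 - v1 * w2)"
  proof -
    have "zform ^ e * (w * v2 - y * w2) = (zform ^ e * w) * v2 - (zform ^ e * y) * w2"
      by (simp only: right_diff_distrib mult.assoc)
    then show ?thesis unfolding W V' by (simp add: algebra_simps)
  qed
  have vanish: "w2 * v1 - v2 * w1 = 0"
  proof (rule ccontr)
    assume nz: "w2 * v1 - v2 * w1 \<noteq> 0"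
    have "zform ^ e dvd w2 * v1 - v2 * w1" using cross1 by (metis dvd_triv_left)
    then have "e \<le> degree (w2 * v1 - v2 * w1)"
      using dvd_imp_degree_le[OF _ nz] by (fastforce simp: degree_power_eq)
    moreover have "degree (w2 * v1) \<le> e - 1"
      using degree_mult_le[of w2 v1] W(3) V(2) d by (auto simp: e_def t_def)
    moreover have "degree (v2 * w1) \<le> e - 1"
      using degree_mult_le[of v2 w1] W(2) V(3) d by (auto simp: e_def t_def)
    moreover have "0 < e" using d by (auto simp: e_def)
    ultimately show False using degree_diff_le[of "w2 * v1" "e - 1" "v2 * w1"] by linarith
  qed
  have ze: "zform ^ e \<noteq> (0 :: 'a poly)" by simp
  have y1: "w * v1 = y * w1" using cross1 ze unfolding vanish by (metis eq_iff_diff_eq_0 mult_eq_0_iff)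
  have "w1 * v2 - v1 * w2 = 0" using vanish by (simp add: algebra_simps)
  then have y2: "w * v2 = y * w2"
    using cross2 ze by (metis eq_iff_diff_eq_0 mult_eq_0_iff mult_zero_right)
  obtain g g1 g2 where g: "g \<noteq> 0" and gen: "\<And>u u1 u2. w * u1 = u * w1 \<Longrightarrow> w * u2 = u * w2 \<Longrightarrow>
      \<exists>q. u = q * g \<and> u1 = q * g1 \<and> u2 = q * g2"
    using rank_one_module_generator[OF w(1)] by metis
  from gen[OF refl refl] obtain c where c: "w = c * g" "w1 = c * g1" "w2 = c * g2" by blast
  from gen[OF y1 y2] obtain b where b: "y = b * g" "v1 = b * g1" "v2 = b * g2" by blast
  have "c \<noteq> 0" using w c by auto
  have G: "zform ^ e * g = monom 1 r * g1 + g2"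
  proof -
    have "c * (zform ^ e * g) = c * (monom 1 r * g1 + g2)"
      using W(1) unfolding c by (simp add: algebra_simps)
    then show ?thesis using \<open>c \<noteq> 0\<close> by simp
  qed
  have dw: "degree w = degree c + degree g" unfolding c using \<open>c \<noteq> 0\<close> g by (simp add: degree_mult_eq)
  have "degree c = 0"
  proof (rule ccontr)
    assume nz: "degree c \<noteq> 0"
    have "degree g2 + 1 \<le> r - k" if "g2 \<noteq> 0"
      using W(3) nz that \<open>c \<noteq> 0\<close> et d unfolding c by (simp add: degree_mult_eq)
    moreover have "degree g \<le> d - 1" using dw nz w(2) by linarith
    ultimately show False using no_gen[OF G g] by blast
  qed
  have "\<not> zform dvd g"
  proof
    assume "zform dvd g"
    then have "zform dvd w" unfolding c by simp
    then obtain w' where w': "w = zform * w'" by (elim dvdE)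
    have "w' \<noteq> 0" using w w' by auto
    have "degree w' \<le> d - 1" using w(2) degree_zform_power_mult[OF \<open>w' \<noteq> 0\<close>, of 1]
      unfolding w' by simp
    moreover have "in_box_ideal r s (d - 1 + (e + 1)) (zform ^ (e + 1) * w')"
    proof -
      have "zform ^ (e + 1) * w' = zform ^ e * w"
        unfolding w' by (simp only: power_add power_one_right mult.assoc)
      moreover have "d - 1 + (e + 1) = d + e" using d by simp
      ultimately show ?thesis using w(3) by simp
    qed
    ultimately show False using contra \<open>w' \<noteq> 0\<close> unfolding has_kernel_def e_def by blast
  qed
  moreover have "zform ^ t dvd g * b" using b(1) unfolding y_def by (metis dvd_triv_right mult.commute)
  ultimately have "zform ^ t dvd b" by (rule zform_power_dvd_cancel)
  then obtain b' where b': "b = zform ^ t * b'" by (elim dvdE)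
  have "zform ^ t * v = zform ^ t * (b' * g)" using b(1) unfolding b' y_def by (simp add: mult_ac)
  then have vb: "v = b' * g" by simp
  have "b' \<noteq> 0" using v vb by auto
  have "degree g \<le> d - 1" using v(2) g \<open>b' \<noteq> 0\<close> unfolding vb by (simp add: degree_mult_eq)
  moreover have "degree g2 + 1 \<le> r - k" if "g2 \<noteq> 0"
  proof -
    have "degree v2 = t + (degree b' + degree g2)"
      unfolding b b' mult.assoc using that \<open>b' \<noteq> 0\<close>
      by (subst degree_zform_power_mult) (auto simp: degree_mult_eq)
    then show ?thesis using V(3) d by (auto simp: e_def t_def)
  qed
  ultimately show False using no_gen[OF G g] by blast
qed

lemma kernel_poly_iff_det:
  fixes A :: "nat \<Rightarrow> nat \<Rightarrow> 'a::field"
  assumes "0 < k"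
  shows "(\<exists>f. f \<noteq> 0 \<and> degree f < k \<and> (\<forall>l<k. (\<Sum>i<k. A l i * coeff f i) = 0)) \<longleftrightarrow>
    det (mat k k (\<lambda>(l, i). A l i)) = 0"
proof -
  let ?M = "mat k k (\<lambda>(l, i). A l i)"
  have Mv: "?M *\<^sub>v v = 0\<^sub>v k \<longleftrightarrow> (\<forall>l<k. (\<Sum>i<k. A l i * v $ i) = 0)"
    if "v \<in> carrier_vec k" for v
    using that by (auto simp: vec_eq_iff scalar_prod_def lessThan_atLeast0)
  have "(\<exists>f. f \<noteq> 0 \<and> degree f < k \<and> (\<forall>l<k. (\<Sum>i<k. A l i * coeff f i) = 0)) \<longleftrightarrow>
    (\<exists>v. v \<in> carrier_vec k \<and> v \<noteq> 0\<^sub>v k \<and> ?M *\<^sub>v v = 0\<^sub>v k)" (is "?L \<longleftrightarrow> ?R")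
  proof
    assume ?L
    then obtain f where f: "f \<noteq> 0" "degree f < k" "\<forall>l<k. (\<Sum>i<k. A l i * coeff f i) = 0"
      by blast
    have "vec k (coeff f) \<noteq> 0\<^sub>v k"
      using f(1,2) by (metis index_vec index_zero_vec(1) leading_coeff_0_iff)
    then show ?R using f(3) by (intro exI[of _ "vec k (coeff f)"]) (simp add: Mv)
  next
    assume ?R
    then obtain v where v: "v \<in> carrier_vec k" "v \<noteq> 0\<^sub>v k" "\<forall>l<k. (\<Sum>i<k. A l i * v $ i) = 0"
      using Mv by blast
    define f where "f = Poly (map (\<lambda>i. v $ i) [0..<k])"
    have co: "coeff f i = (if i < k then v $ i else 0)" for i
      by (simp add: f_def nth_default_def)
    obtain i where "i < k" "v $ i \<noteq> 0" using v by (auto simp: vec_eq_iff)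
    then have "f \<noteq> 0" using co by (metis coeff_0)
    moreover have "degree f < k"
      using \<open>0 < k\<close> by (intro le_less_trans[OF degree_le[of "k - 1" f]]) (auto simp: co)
    ultimately show ?L using v(3) by (intro exI[of _ f]) (simp add: co)
  qed
  also have "\<dots> \<longleftrightarrow> det ?M = 0"
    by (rule det_0_iff_vec_prod_zero_field[symmetric]) simp
  finally show ?thesis .
qed

lemma coeff_zform_power_mult:
  fixes f :: "'a::field poly"
  assumes "degree f < k"
  shows "coeff (zform ^ m * f) n =
    (\<Sum>i<k. of_nat (if i \<le> n then m choose (n - i) else 0) * coeff f i)"
proof -
  have "coeff (zform ^ m * f) n = (\<Sum>i\<le>n. coeff f i * of_nat (m choose (n - i)))"
    unfolding mult.commute[of "zform ^ m"] coeff_mult coeff_zform_power ..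
  also have "\<dots> = (\<Sum>i<k + Suc n. of_nat (if i \<le> n then m choose (n - i) else 0) * coeff f i)"
    by (intro sum.mono_neutral_cong_left) (auto simp: mult.commute)
  also have "\<dots> = (\<Sum>i<k. of_nat (if i \<le> n then m choose (n - i) else 0) * coeff f i)"
    using assms by (intro sum.mono_neutral_right) (auto intro: coeff_eq_0)
  finally show ?thesis .
qed

lemma lefschetz_iff_det:
  assumes k: "0 < k" "k \<le> r" "r \<le> s"
  shows "lefschetz TYPE('a::field) r s k \<longleftrightarrow>
    of_int (det (shifted_binomial_mat (r - k) (s - k) k)) \<noteq> (0 :: 'a)"
proof -
  define A :: "nat \<Rightarrow> nat \<Rightarrow> 'a" where
    "A l i = of_nat (if i \<le> r - k + l then (r - k + (s - k)) choose (r - k + l - i) else 0)" for l i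
  have m: "r + s - 2 * k = r - k + (s - k)" using k by simp
  have window: "in_box_ideal r s (k - 1 + (r + s - 2 * k)) g \<longleftrightarrow> (\<forall>l<k. coeff g (r - k + l) = 0)"
    for g :: "'a poly"
  proof -
    have "in_box_ideal r s (k - 1 + (r + s - 2 * k)) g \<longleftrightarrow> (\<forall>l. r - k \<le> l \<and> l < r \<longrightarrow> coeff g l = 0)"
      unfolding in_box_ideal_def using k by (intro all_cong1) auto
    also have "\<dots> \<longleftrightarrow> (\<forall>l<k. coeff g (r - k + l) = 0)"
    proof safe
      fix l assume *: "\<forall>l<k. coeff g (r - k + l) = 0" "r - k \<le> l" "l < r"
      then show "coeff g l = 0" using k by (auto dest!: spec[of _ "l - (r - k)"])
    next
      fix l assume *: "\<forall>l. r - k \<le> l \<and> l < r \<longrightarrow> coeff g l = 0" "l < k"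
      have "r - k \<le> r - k + l" "r - k + l < r" using k \<open>l < k\<close> by linarith+
      then show "coeff g (r - k + l) = 0" using * by blast
    qed
    finally show ?thesis .
  qed
  have "has_kernel TYPE('a) r s (k - 1) (r + s - 2 * k) \<longleftrightarrow>
     (\<exists>f. f \<noteq> 0 \<and> degree f < k \<and> (\<forall>l<k. (\<Sum>i<k. A l i * coeff f i) = 0))"
    unfolding has_kernel_def window
  proof (intro ex_cong1 conj_cong refl)
    fix f :: "'a poly" assume "degree f < k"
    then show "(\<forall>l<k. coeff (zform ^ (r + s - 2 * k) * f) (r - k + l) = 0) \<longleftrightarrow>
      (\<forall>l<k. (\<Sum>i<k. A l i * coeff f i) = 0)"
      unfolding A_def m by (simp only: coeff_zform_power_mult)
  qed (use k in auto)
  also have "\<dots> \<longleftrightarrow> det (mat k k (\<lambda>(l, i). A l i)) = 0"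
    using k by (intro kernel_poly_iff_det)
  also have "mat k k (\<lambda>(l, i). A l i) = map_mat of_int (shifted_binomial_mat (r - k) (s - k) k)"
    unfolding A_def shifted_binomial_mat_def by (rule eq_matI) auto
  also have "det \<dots> = of_int (det (shifted_binomial_mat (r - k) (s - k) k))"
    by (rule of_int_hom.hom_det)
  finally show ?thesis using k unfolding lefschetz_def by simp
qed

lemma lefschetz_top:
  assumes "r \<le> s"
  shows "lefschetz TYPE('a::field) r s r"
proof (cases "r = 0")
  case False
  have "det (shifted_binomial_mat 0 (s - r) r) * (\<Prod>i<r. fact i * fact (s - r + i)) =
      (\<Prod>i<r. fact i * fact (s - r + i))"
    using det_shifted_binomial_mat[of 0 "s - r" r] by (simp add: mult.commute)
  then have "det (shifted_binomial_mat 0 (s - r) r) = 1" by simp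
  then show ?thesis using assms False by (subst lefschetz_iff_det) auto
qed (simp add: lefschetz_def)

text \<open>One power of \<open>z\<close> beyond the symmetric position the target has dimension \<open>k-1\<close> only, so a kernel exists.\<close>
lemma has_kernel_by_dimension:
  assumes k: "0 < k" "k \<le> r" "r \<le> s"
  shows "has_kernel TYPE('a::field) r s (k - 1) (r + s - 2 * k + 1)"
proof -
  let ?m = "r + s - 2 * k + 1"
  define A :: "nat \<Rightarrow> nat \<Rightarrow> 'a" where
    "A l i = (if l = 0 then 0 else of_nat (if i \<le> r - k + l then ?m choose (r - k + l - i) else 0))"
    for l i
  \<comment> \<open>Only \<open>k - 1\<close> coefficients have to vanish; a zero equation makes the system square.\<close>
  have "mat k k (\<lambda>(l, i). A l i) = mat\<^sub>r k k (\<lambda>l. if l = 0 then 0\<^sub>v k else vec k (A l))"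
    by (rule eq_matI) (auto simp: A_def)
  then have "det (mat k k (\<lambda>(l, i). A l i)) = 0"
    using det_row_0[OF k(1), of "\<lambda>l. vec k (A l)"] by simp
  then obtain f where f: "f \<noteq> 0" "degree f < k" "\<forall>l<k. (\<Sum>i<k. A l i * coeff f i) = 0"
    using kernel_poly_iff_det[OF k(1), of A] by blast
  have "coeff (zform ^ ?m * f) l = 0" if "r - k < l" "l < r" for l
  proof -
    have l: "l - (r - k) \<noteq> 0" "l - (r - k) < k" "r - k + (l - (r - k)) = l" using that by auto
    from f(3) l(2) have "(\<Sum>i<k. A (l - (r - k)) i * coeff f i) = 0" by blast
    then show ?thesis unfolding coeff_zform_power_mult[OF f(2)] A_def l(3) using l(1) by simp
  qed
  then have "in_box_ideal r s (k - 1 + ?m) (zform ^ ?m * f)"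
    unfolding in_box_ideal_def using k by auto
  then show ?thesis unfolding has_kernel_def using f by (intro exI[of _ f]) auto
qed

text \<open>Start from the kernel in degree \<open>k1-1\<close> that exists for reasons of dimension, and descend: as long as the
  degree is a non-Lefschetz index, the kernel element can be replaced by one of smaller degree with the
  same degree of the image.  The descent stops at the preceding Lefschetz index \<open>k0\<close>.  One power of \<open>z\<close>
  less is injective, since \<open>k1\<close> is a Lefschetz index.\<close>
lemma string_generator:
  assumes k: "k0 < k1" "k1 \<le> r" "r \<le> s"
    and lef: "lefschetz TYPE('a::field) r s k1"
    and gap: "\<And>k. k0 < k \<Longrightarrow> k < k1 \<Longrightarrow> \<not> lefschetz TYPE('a) r s k"
  obtains w :: "'a::field poly" where
    "in_box_ideal r s (r + s - k1) (zform ^ (r + s - k0 - k1) * w)"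
    "\<not> in_box_ideal r s (r + s - k1 - 1) (zform ^ (r + s - k0 - k1 - 1) * w)"
    "degree w \<le> k0"
proof -
  have "has_kernel TYPE('a) r s d (r + s - k1 - d)" if "k0 \<le> d" "d \<le> k1 - 1" for d
    using that(2,1)
  proof (induction d rule: inc_induct)
    case base
    have "r + s - 2 * k1 + 1 = r + s - k1 - (k1 - 1)" using k by simp
    then show ?case using has_kernel_by_dimension[of k1 r s] k by simp
  next
    case (step d)
    have "has_kernel TYPE('a) r s (Suc d - 1) (r + s - k1 - Suc d + 1)"
      using step k gap[of "Suc d"] by (intro kernel_descent) auto
    moreover have "r + s - k1 - Suc d + 1 = r + s - k1 - d" using step k by simp
    ultimately show ?case by simp
  qed
  from this[of k0] k have "has_kernel TYPE('a) r s k0 (r + s - k0 - k1)"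
    by (simp add: diff_commute[of "r + s" k0 k1] del: diff_diff_left)
  then obtain w :: "'a poly" where w: "w \<noteq> 0" "degree w \<le> k0"
    "in_box_ideal r s (k0 + (r + s - k0 - k1)) (zform ^ (r + s - k0 - k1) * w)"
    unfolding has_kernel_def by blast
  show ?thesis
  proof (rule that[OF _ _ w(2)])
    show "in_box_ideal r s (r + s - k1) (zform ^ (r + s - k0 - k1) * w)"
      using w(3) k by (simp add: algebra_simps)
    show "\<not> in_box_ideal r s (r + s - k1 - 1) (zform ^ (r + s - k0 - k1 - 1) * w)"
    proof
      have eq: "r + s - k1 - 1 = k0 + (r + s - k0 - k1 - 1)"
        "r + s - k0 - k1 - 1 = r + s - 2 * k1 + (k1 - 1 - k0)" "k0 + (k1 - 1 - k0) = k1 - 1"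
        using k by auto
      assume "in_box_ideal r s (r + s - k1 - 1) (zform ^ (r + s - k0 - k1 - 1) * w)"
      then have "has_kernel TYPE('a) r s k0 (r + s - k0 - k1 - 1)"
        unfolding has_kernel_def eq(1) using w by blast
      then have "has_kernel TYPE('a) r s (k1 - 1) (r + s - 2 * k1)"
        unfolding eq(2) using has_kernel_trade[of r s k0] eq(3) by metis
      then show False using lef k unfolding lefschetz_def by simp
    qed
  qed
qed

text \<open>Multiplying the generator of a string by powers of \<open>x\<close> does not shorten the string: its last element
  \<open>u\<close> is killed by \<open>x + y\<close>, hence its coefficients alternate in sign across the box, and none of them
  can vanish unless all do.\<close>
lemma string_shift_nonzero:
  fixes u :: "'a::field poly"
  assumes k: "0 < k" "k \<le> r" "r \<le> s" and i: "i < k"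
    and ker: "in_box_ideal r s (r + s - k) (zform * u)"
    and nz: "\<not> in_box_ideal r s (r + s - k - 1) u"
  shows "\<not> in_box_ideal r s (r + s - k - 1 + i) (monom 1 i * u)"
proof -
  have alt: "coeff u (r - k + j) = (- 1) ^ j * coeff u (r - k)" if "j < k" for j
    using that
  proof (induction j)
    case (Suc j)
    have "r - k + Suc j \<le> r + s - k" "r - k + Suc j < r" "r + s - k - (r - k + Suc j) < s"
      using Suc.prems k by linarith+
    then have "coeff (zform * u) (r - k + Suc j) = 0"
      using ker unfolding in_box_ideal_def by blast
    then have "coeff u (r - k + Suc j) = - coeff u (r - k + j)"
      unfolding coeff_zform_mult by (simp add: eq_neg_iff_add_eq_0)
    then show ?case using Suc by simp
  qed simp
  obtain l where l: "r - k \<le> l" "l < r" "coeff u l \<noteq> 0"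
    using nz k unfolding in_box_ideal_def by force
  have "coeff u (r - k) \<noteq> 0" using alt[of "l - (r - k)"] l k by auto
  then have "coeff u (r - 1 - i) \<noteq> 0" using alt[of "k - 1 - i"] i k by auto
  then have "coeff (monom 1 i * u) (r - 1) \<noteq> 0" using i k by (simp add: coeff_monom_mult)
  moreover have "r - 1 \<le> r + s - k - 1 + i" "r - 1 < r" "r + s - k - 1 + i - (r - 1) < s"
    using k i by auto
  ultimately show ?thesis unfolding in_box_ideal_def by blast
qed

section \<open>Jordan bases made of chains\<close>

fun chain_cols :: "nat list \<Rightarrow> (nat \<Rightarrow> nat \<Rightarrow> 'a vec) \<Rightarrow> 'a vec list" where
  "chain_cols [] u = []"
| "chain_cols (L # Ls) u = map (u 0) [0..<L] @ chain_cols Ls (\<lambda>d. u (Suc d))"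

lemma length_chain_cols [simp]: "length (chain_cols Ls u) = sum_list Ls"
  by (induction Ls arbitrary: u) auto

text \<open>The vectors are numbered as the columns of a Jordan block: \<open>u 0\<close> is the eigenvector.\<close>
definition jordan_chain :: "nat \<Rightarrow> 'a::field mat \<Rightarrow> nat \<Rightarrow> (nat \<Rightarrow> 'a vec) \<Rightarrow> bool" where
  "jordan_chain N K L u \<longleftrightarrow> (\<forall>i<L. u i \<in> carrier_vec N \<and>
     K *\<^sub>v u i = u i + (if i = 0 then 0\<^sub>v N else u (i - 1)))"

lemma jordan_block_col_sum:
  fixes y :: "nat \<Rightarrow> 'a::field"
  assumes "i < L"
  shows "(\<Sum>i'<L. y i' * jordan_block L 1 $$ (i', i)) = y i + (if i = 0 then 0 else y (i - 1))"
proof -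
  have "(\<Sum>i'<L. y i' * jordan_block L 1 $$ (i', i)) =
    (\<Sum>i'<L. (if i' = i then y i' else 0) + (if 0 < i \<and> i' = i - 1 then y i' else 0))"
    using assms by (intro sum.cong) auto
  also have "\<dots> = y i + (if i = 0 then 0 else y (i - 1))"
    using assms by (simp add: sum.distrib sum.If_cases)
  finally show ?thesis .
qed

lemma jordan_block_row_sum:
  fixes y :: "nat \<Rightarrow> 'a::field"
  assumes "i < L"
  shows "(\<Sum>i'<L. jordan_block L 1 $$ (i, i') * y i') = y i + (if Suc i < L then y (Suc i) else 0)"
proof -
  have "(\<Sum>i'<L. jordan_block L 1 $$ (i, i') * y i') =
    (\<Sum>i'<L. (if i' = i then y i' else 0) + (if i' = Suc i then y i' else 0))"
    using assms by (intro sum.cong) auto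
  also have "\<dots> = y i + (if Suc i < L then y (Suc i) else 0)"
    using assms by (simp add: sum.distrib)
  finally show ?thesis .
qed

lemma mult_mat_vec_nth:
  assumes "A \<in> carrier_mat m n" "v \<in> carrier_vec n" "t < m"
  shows "(A *\<^sub>v v) $ t = (\<Sum>t'<n. A $$ (t, t') * v $ t')"
  using assms by (auto simp: scalar_prod_def lessThan_atLeast0)

lemma jordan_chain_mult:
  fixes K :: "'a::field mat"
  assumes K: "K \<in> carrier_mat N N" and ch: "jordan_chain N K L u"
  shows "K * mat_of_cols N (map u [0..<L]) = mat_of_cols N (map u [0..<L]) * jordan_block L 1"
    (is "K * ?P = _")
proof (rule eq_matI)
  fix t i assume "t < dim_row (?P * jordan_block L 1)" "i < dim_col (?P * jordan_block L 1)"
  then have t: "t < N" and i: "i < L" by auto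
  have u: "u i' \<in> carrier_vec N" if "i' < L" for i' using ch that unfolding jordan_chain_def by blast
  have "col ?P i = u i" using i u by (subst col_mat_of_cols) auto
  then have "(K * ?P) $$ (t, i) = (K *\<^sub>v u i) $ t" using K t i by auto
  also have "\<dots> = u i $ t + (if i = 0 then 0 else u (i - 1) $ t)"
  proof -
    have "K *\<^sub>v u i = u i + (if i = 0 then 0\<^sub>v N else u (i - 1))"
      using ch i unfolding jordan_chain_def by blast
    moreover have "u (i - 1) \<in> carrier_vec N" using u i by simp
    ultimately show ?thesis using t u[OF i] by auto
  qed
  also have "\<dots> = (\<Sum>i'<L. u i' $ t * jordan_block L 1 $$ (i', i))"
    using jordan_block_col_sum[OF i, of "\<lambda>i'. u i' $ t"] by simp
  also have "\<dots> = (?P * jordan_block L 1) $$ (t, i)"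
    using t i by (simp add: scalar_prod_def mat_of_cols_index lessThan_atLeast0 del: jordan_block_index(1))
  finally show "(K * ?P) $$ (t, i) = (?P * jordan_block L 1) $$ (t, i)" .
qed (use K in auto)

lemma jordan_chains_mult:
  fixes K :: "'a::field mat"
  assumes K: "K \<in> carrier_mat N N"
    and ch: "\<And>d. d < length Ls \<Longrightarrow> jordan_chain N K (Ls ! d) (u d)"
  shows "K * mat_of_cols N (chain_cols Ls u) =
    mat_of_cols N (chain_cols Ls u) * jordan_matrix (map (\<lambda>m. (m, 1)) Ls)"
  using ch
proof (induction Ls arbitrary: u)
  case Nil
  show ?case using K by (auto simp: jordan_matrix_def intro!: eq_matI)
next
  case (Cons L Ls)
  let ?P1 = "mat_of_cols N (map (u 0) [0..<L])"
  let ?u = "\<lambda>d. u (Suc d)" and ?n = "sum_list Ls"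
  let ?P2 = "mat_of_cols N (chain_cols Ls ?u)"
  let ?J = "jordan_matrix (map (\<lambda>m. (m, 1 :: 'a)) Ls)"
  have J: "?J \<in> carrier_mat ?n ?n"
    using jordan_matrix_carrier[of "map (\<lambda>m. (m, 1 :: 'a)) Ls"] by (simp add: comp_def)
  have P: "?P1 \<in> carrier_mat N L" "?P2 \<in> carrier_mat N ?n"
    using mat_of_cols_carrier(1)[of N "map (u 0) [0..<L]"]
      mat_of_cols_carrier(1)[of N "chain_cols Ls ?u"] by auto
  have split: "mat_of_cols N (chain_cols (L # Ls) u) = four_block_mat ?P1 ?P2 (0\<^sub>m 0 L) (0\<^sub>m 0 ?n)"
    by (rule eq_matI) (auto simp: mat_of_cols_index nth_append)
  have Keq: "K = four_block_mat K (0\<^sub>m N 0) (0\<^sub>m 0 N) (0\<^sub>m 0 0)"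
    using K by (intro eq_matI) auto
  have Jeq: "jordan_matrix (map (\<lambda>m. (m, 1 :: 'a)) (L # Ls)) =
      four_block_mat (jordan_block L 1) (0\<^sub>m L ?n) (0\<^sub>m ?n L) ?J"
    unfolding jordan_matrix_def using J by (simp add: Let_def jordan_matrix_def)
  have ch: "jordan_chain N K L (u 0)" using Cons.prems[of 0] by simp
  have "K * mat_of_cols N (chain_cols (L # Ls) u) =
      four_block_mat (K * ?P1) (K * ?P2) (0\<^sub>m 0 L) (0\<^sub>m 0 ?n)"
    unfolding split using K P
    by (subst Keq, subst mult_four_block_mat[of _ N N _ 0 _ 0 _ _ L _ ?n]) auto
  also have "K * ?P1 = ?P1 * jordan_block L 1" by (rule jordan_chain_mult[OF K ch])
  also have "K * ?P2 = ?P2 * ?J"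
    using Cons.prems[of "Suc d" for d] by (intro Cons.IH) auto
  also have "four_block_mat (?P1 * jordan_block L 1) (?P2 * ?J) (0\<^sub>m 0 L) (0\<^sub>m 0 ?n) =
      mat_of_cols N (chain_cols (L # Ls) u) * jordan_matrix (map (\<lambda>m. (m, 1)) (L # Ls))"
    unfolding split Jeq using P J
    by (subst mult_four_block_mat[of _ N L _ ?n _ 0 _ _ L _ ?n]) auto
  finally show ?case .
qed

text \<open>Passes from coefficients indexed by matrix columns to coefficients indexed by chain and position.\<close>
lemma chain_cols_combination:
  fixes c :: "nat \<Rightarrow> 'a::field"
  shows "\<exists>\<gamma>. (\<forall>t. (\<Sum>j<sum_list Ls. c j * chain_cols Ls u ! j $ t) =
      (\<Sum>d<length Ls. \<Sum>i<Ls ! d. \<gamma> d i * u d i $ t)) \<and>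
    ((\<forall>d<length Ls. \<forall>i<Ls ! d. \<gamma> d i = 0) \<longrightarrow> (\<forall>j<sum_list Ls. c j = 0))"
proof (induction Ls arbitrary: u c)
  case (Cons L Ls)
  obtain \<gamma> where g: "\<And>t. (\<Sum>j<sum_list Ls. c (L + j) * chain_cols Ls (\<lambda>d. u (Suc d)) ! j $ t) =
      (\<Sum>d<length Ls. \<Sum>i<Ls ! d. \<gamma> d i * u (Suc d) i $ t)"
    "(\<forall>d<length Ls. \<forall>i<Ls ! d. \<gamma> d i = 0) \<longrightarrow> (\<forall>j<sum_list Ls. c (L + j) = 0)"
    using Cons[of "\<lambda>j. c (L + j)" "\<lambda>d. u (Suc d)"] by blast
  define \<delta> where "\<delta> = case_nat c \<gamma>"
  show ?case
  proof (intro exI[of _ \<delta>] conjI allI impI)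
    fix t
    have "(\<Sum>j<L + n. f j) = (\<Sum>j<L. f j) + (\<Sum>j<n. f (L + j))" for n and f :: "nat \<Rightarrow> 'a"
      by (induction n) (auto simp: add.assoc)
    then show "(\<Sum>j<sum_list (L # Ls). c j * chain_cols (L # Ls) u ! j $ t) =
      (\<Sum>d<length (L # Ls). \<Sum>i<(L # Ls) ! d. \<delta> d i * u d i $ t)"
      by (simp add: nth_append sum.lessThan_Suc_shift g(1) \<delta>_def del: sum.lessThan_Suc)
  next
    fix j assume z: "\<forall>d<length (L # Ls). \<forall>i<(L # Ls) ! d. \<delta> d i = 0" and j: "j < sum_list (L # Ls)"
    have "\<forall>i<L. c i = 0" using z[rule_format, of 0] by (simp add: \<delta>_def)
    moreover have "\<forall>d<length Ls. \<forall>i<Ls ! d. \<gamma> d i = 0"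
      using z[rule_format, of "Suc d" for d] by (simp add: \<delta>_def)
    then have "\<forall>j<sum_list Ls. c (L + j) = 0" using g(2) by blast
    ultimately show "c j = 0"
      using j by (cases "j < L") (auto dest!: spec[of _ "j - L"])
  qed
qed auto

lemma sum_drop_first:
  fixes a b :: "nat \<Rightarrow> 'a::field"
  shows "(\<Sum>i<L. a i * (if i = 0 then 0 else b (i - 1))) =
    (\<Sum>i<L. (if Suc i < L then a (Suc i) else 0) * b i)"
proof (cases L)
  case (Suc n)
  show ?thesis unfolding Suc
    by (subst sum.lessThan_Suc_shift) (auto intro: sum.cong)
qed auto

text \<open>Chains are linearly independent as soon as their eigenvectors are: applying \<open>K - 1\<close> to a relation
  moves every coefficient one step towards the eigenvector, so the relation obtained involves shorter
  chains.  The induction is on a bound \<open>T\<close> for the positions that occur in the relation.\<close>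
lemma jordan_chains_independent:
  fixes K :: "'a::field mat" and \<gamma> :: "nat \<Rightarrow> nat \<Rightarrow> 'a"
  assumes K: "K \<in> carrier_mat N N"
    and ch: "\<And>d. d < n \<Longrightarrow> jordan_chain N K (Ls d) (u d)"
    and pos: "\<And>d. d < n \<Longrightarrow> 0 < Ls d"
    and bot: "\<And>c. (\<And>t. t < N \<Longrightarrow> (\<Sum>d<n. c d * u d 0 $ t) = 0) \<Longrightarrow> \<forall>d<n. c d = 0"
    and bound: "\<And>d i. d < n \<Longrightarrow> i < Ls d \<Longrightarrow> T \<le> i \<Longrightarrow> \<gamma> d i = 0"
    and zero: "\<And>t. t < N \<Longrightarrow> (\<Sum>d<n. \<Sum>i<Ls d. \<gamma> d i * u d i $ t) = 0"
  shows "\<forall>d<n. \<forall>i<Ls d. \<gamma> d i = 0"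
  using bound zero
proof (induction T arbitrary: \<gamma>)
  case (Suc T)
  define \<delta> where "\<delta> d i = (if Suc i < Ls d then \<gamma> d (Suc i) else 0)" for d i
  have "(\<Sum>d<n. \<Sum>i<Ls d. \<delta> d i * u d i $ t) = 0" if t: "t < N" for t
  proof -
    have "0 = (\<Sum>t'<N. K $$ (t, t') * (\<Sum>d<n. \<Sum>i<Ls d. \<gamma> d i * u d i $ t'))"
      using Suc.prems(2) by simp
    also have "\<dots> = (\<Sum>d<n. \<Sum>i<Ls d. \<gamma> d i * (\<Sum>t'<N. K $$ (t, t') * u d i $ t'))"
    proof -
      have "(\<Sum>t'<N. K $$ (t, t') * (\<Sum>d<n. \<Sum>i<Ls d. \<gamma> d i * u d i $ t')) =
          (\<Sum>t'<N. \<Sum>d<n. \<Sum>i<Ls d. \<gamma> d i * (K $$ (t, t') * u d i $ t'))"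
        by (simp add: sum_distrib_left mult.left_commute)
      also have "\<dots> = (\<Sum>d<n. \<Sum>t'<N. \<Sum>i<Ls d. \<gamma> d i * (K $$ (t, t') * u d i $ t'))"
        by (rule sum.swap)
      also have "\<dots> = (\<Sum>d<n. \<Sum>i<Ls d. \<Sum>t'<N. \<gamma> d i * (K $$ (t, t') * u d i $ t'))"
        by (intro sum.cong refl sum.swap)
      finally show ?thesis by (simp only: sum_distrib_left)
    qed
    also have "\<dots> = (\<Sum>d<n. \<Sum>i<Ls d. \<gamma> d i * (u d i $ t + (if i = 0 then 0 else u d (i - 1) $ t)))"
    proof (intro sum.cong refl, goal_cases)
      case (1 d i)
      then have d: "d < n" and i: "i < Ls d" by auto
      note c = ch[OF d, unfolded jordan_chain_def, rule_format]
      have "(\<Sum>t'<N. K $$ (t, t') * u d i $ t') = (K *\<^sub>v u d i) $ t"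
        using c[OF i] by (intro mult_mat_vec_nth[OF K _ t, symmetric]) blast
      also have "\<dots> = u d i $ t + (if i = 0 then 0 else u d (i - 1) $ t)"
      proof -
        have "u d (i - 1) \<in> carrier_vec N" using c[of "i - 1"] i by simp
        then show ?thesis using c[OF i] t by auto
      qed
      finally show ?case by simp
    qed
    also have "\<dots> = (\<Sum>d<n. \<Sum>i<Ls d. \<gamma> d i * u d i $ t) +
        (\<Sum>d<n. \<Sum>i<Ls d. \<gamma> d i * (if i = 0 then 0 else u d (i - 1) $ t))"
      by (simp only: distrib_left sum.distrib)
    also have "\<dots> = (\<Sum>d<n. \<Sum>i<Ls d. \<delta> d i * u d i $ t)"
      unfolding \<delta>_def Suc.prems(2)[OF t]
      by (simp only: sum_drop_first[where b = "\<lambda>i. u d i $ t" for d] add_0_left)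
    finally show ?thesis by simp
  qed
  then have "\<forall>d<n. \<forall>i<Ls d. \<delta> d i = 0"
    using Suc.prems(1) by (intro Suc.IH) (auto simp: \<delta>_def)
  then have d0: "\<delta> d i = 0" if "d < n" "i < Ls d" for d i using that by blast
  have up: "\<gamma> d i = 0" if "d < n" "i < Ls d" "i \<noteq> 0" for d i
    using d0[of d "i - 1"] that by (simp add: \<delta>_def)
  have "(\<Sum>d<n. \<gamma> d 0 * u d 0 $ t) = 0" if t: "t < N" for t
  proof -
    have "(\<Sum>i<Ls d. \<gamma> d i * u d i $ t) = \<gamma> d 0 * u d 0 $ t" if "d < n" for d
      using pos[OF that] up[OF that] by (subst sum.remove[of _ 0]) auto
    then have "(\<Sum>d<n. \<gamma> d 0 * u d 0 $ t) = (\<Sum>d<n. \<Sum>i<Ls d. \<gamma> d i * u d i $ t)"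
      by (intro sum.cong) auto
    then show ?thesis using Suc.prems(2)[OF t] by simp
  qed
  then have "\<forall>d<n. \<gamma> d 0 = 0" by (rule bot)
  then show ?case using up by metis
qed auto

lemma jordan_nf_from_chains:
  fixes K :: "'a::field mat"
  assumes K: "K \<in> carrier_mat N N" and N: "sum_list Ls = N"
    and ch: "\<And>d. d < length Ls \<Longrightarrow> jordan_chain N K (Ls ! d) (u d)"
    and pos: "\<And>d. d < length Ls \<Longrightarrow> 0 < Ls ! d"
    and bot: "\<And>c. (\<And>t. t < N \<Longrightarrow> (\<Sum>d<length Ls. c d * u d 0 $ t) = 0) \<Longrightarrow>
      \<forall>d<length Ls. c d = 0"
  shows "jordan_nf K (map (\<lambda>m. (m, 1)) Ls)"
proof -
  let ?P = "mat_of_cols N (chain_cols Ls u)" and ?J = "jordan_matrix (map (\<lambda>m. (m, 1 :: 'a)) Ls)"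
  have P: "?P \<in> carrier_mat N N" using N mat_of_cols_carrier(1)[of N "chain_cols Ls u"] by simp
  have J: "?J \<in> carrier_mat N N"
    using N jordan_matrix_carrier[of "map (\<lambda>m. (m, 1 :: 'a)) Ls"] by (simp add: comp_def)
  have "det ?P \<noteq> 0"
  proof
    assume "det ?P = 0"
    then obtain v where v: "v \<in> carrier_vec N" "v \<noteq> 0\<^sub>v N" "?P *\<^sub>v v = 0\<^sub>v N"
      using det_0_iff_vec_prod_zero_field[OF P] by blast
    obtain \<gamma> where g: "\<And>t. (\<Sum>j<sum_list Ls. v $ j * chain_cols Ls u ! j $ t) =
        (\<Sum>d<length Ls. \<Sum>i<Ls ! d. \<gamma> d i * u d i $ t)"
      "(\<forall>d<length Ls. \<forall>i<Ls ! d. \<gamma> d i = 0) \<longrightarrow> (\<forall>j<sum_list Ls. v $ j = 0)"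
      using chain_cols_combination[where Ls = Ls and u = u and c = "\<lambda>j. v $ j"] by blast
    have "(\<Sum>d<length Ls. \<Sum>i<Ls ! d. \<gamma> d i * u d i $ t) = 0" if t: "t < N" for t
    proof -
      have "(\<Sum>j<sum_list Ls. v $ j * chain_cols Ls u ! j $ t) = (?P *\<^sub>v v) $ t"
        unfolding mult_mat_vec_nth[OF P v(1) t] N
        using t N by (intro sum.cong) (auto simp: mat_of_cols_index mult.commute)
      then show ?thesis using g(1)[of t] v(3) t by simp
    qed
    moreover have "Ls ! d \<le> N" if "d < length Ls" for d
      unfolding N[symmetric] using that by (intro member_le_sum_list) auto
    ultimately have "\<forall>d<length Ls. \<forall>i<Ls ! d. \<gamma> d i = 0"
      by (intro jordan_chains_independent[OF K, where u = u and T = N] ch pos bot) force+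
    then have "v = 0\<^sub>v N" using g(2) v(1) N by (intro eq_vecI) auto
    then show False using v(2) by contradiction
  qed
  then obtain Q where Q: "Q \<in> carrier_mat N N" "Q * ?P = 1\<^sub>m N" "?P * Q = 1\<^sub>m N"
    using det_non_zero_imp_unit[OF P] unfolding Units_def ring_mat_def by auto
  have "K = ?P * ?J * Q"
  proof -
    have "?P * ?J * Q = K * ?P * Q" using jordan_chains_mult[OF K ch] by simp
    also have "\<dots> = K" using K P Q by (simp add: assoc_mult_mat[of _ N N _ N _ N])
    finally show ?thesis by simp
  qed
  then have "similar_mat K ?J"
    using K P J Q by (intro similar_matI[of K ?J ?P Q N]) auto
  moreover have "0 \<notin> fst ` set (map (\<lambda>m. (m, 1 :: 'a)) Ls)"
    using pos by (force simp: in_set_conv_nth)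
  ultimately show ?thesis unfolding jordan_nf_def by simp
qed

section \<open>The Kronecker product acting on forms\<close>

text \<open>The coefficient of \<open>X\<^sup>i Y\<^sup>j\<close> in the form represented by \<open>g\<close> in degree \<open>D\<close>, after substituting \<open>x = X\<close> and
  \<open>y = Y (1 + X)\<close>.  Under this substitution \<open>z = x + y\<close> becomes \<open>(1 + X) (1 + Y) - 1\<close>, and \<open>K - 1\<close> acts as
  multiplication by it, where \<open>K\<close> is the Kronecker product.\<close>
definition box_entry :: "nat \<Rightarrow> 'a::field poly \<Rightarrow> nat \<Rightarrow> nat \<Rightarrow> 'a" where
  "box_entry D g i j =
     (if j \<le> D \<and> D \<le> i + j then coeff g (D - j) * of_nat (j choose (i + j - D)) else 0)"

text \<open>Exponents are counted backwards because a Jordan block maps each basis vector to itself plus the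
  preceding one, while multiplication by \<open>1 + X\<close> raises exponents.\<close>
definition box_vec :: "nat \<Rightarrow> nat \<Rightarrow> (nat \<Rightarrow> nat \<Rightarrow> 'a) \<Rightarrow> 'a vec" where
  "box_vec r s F = vec (r * s) (\<lambda>t. F (r - 1 - t div s) (s - 1 - t mod s))"

text \<open>Multiplication by \<open>X + Y + X Y\<close>, the image of \<open>z\<close>; the binomial coefficients combine by Pascal's rule.\<close>
lemma box_entry_step:
  fixes g :: "'a::field poly"
  assumes deg: "degree g \<le> D"
  shows "box_entry (Suc D) (zform * g) i j =
    (if i = 0 then 0 else box_entry D g (i - 1) j) + (if j = 0 then 0 else box_entry D g i (j - 1)) +
    (if i = 0 \<or> j = 0 then 0 else box_entry D g (i - 1) (j - 1))"
proof (cases "j \<le> Suc D \<and> Suc D \<le> i + j")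
  case False
  have outside: "box_entry E h a b = 0" if "\<not> (b \<le> E \<and> E \<le> a + b)" for E a b and h :: "'a poly"
    using that unfolding box_entry_def by (rule if_not_P)
  have "box_entry D g (i - 1) j = 0" if "i \<noteq> 0"
    by (rule outside) (use False that in linarith)
  moreover have "box_entry D g i (j - 1) = 0" if "j \<noteq> 0"
    by (rule outside) (use False that in linarith)
  moreover have "box_entry D g (i - 1) (j - 1) = 0" if "i \<noteq> 0" "j \<noteq> 0"
    by (rule outside) (use False that in linarith)
  ultimately show ?thesis
    unfolding outside[OF False] by (cases "i = 0"; cases "j = 0") simp_all
next
  case True
  define x where "x = i + j - Suc D"
  have ij: "i + j = Suc D + x" unfolding x_def using True by linarith
  have top: "coeff g (Suc D) = 0" using deg by (intro coeff_eq_0) simp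
  have lhs: "box_entry (Suc D) (zform * g) i j =
      (coeff g (Suc D - j) + (if j = Suc D then 0 else coeff g (D - j))) * of_nat (j choose x)"
  proof -
    have "coeff (zform * g) (Suc D - j) =
        coeff g (Suc D - j) + (if j = Suc D then 0 else coeff g (D - j))"
      unfolding coeff_zform_mult using True by auto
    then show ?thesis using True by (simp only: box_entry_def x_def if_True simp_thms)
  qed
  have one: "(if i = 0 then 0 else box_entry D g (i - 1) j) =
      (if j = Suc D then 0 else coeff g (D - j)) * of_nat (j choose x)"
  proof (cases "i = 0 \<or> j = Suc D")
    case True
    then show ?thesis using ij \<open>j \<le> Suc D \<and> Suc D \<le> i + j\<close> by (auto simp: box_entry_def)
  next
    case False
    then have "j \<le> D" "D \<le> i - 1 + j" "i - 1 + j - D = x"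
      using True ij by linarith+
    then show ?thesis using False by (simp add: box_entry_def)
  qed
  have two: "(if j = 0 then 0 else box_entry D g i (j - 1)) +
      (if i = 0 \<or> j = 0 then 0 else box_entry D g (i - 1) (j - 1)) =
      coeff g (Suc D - j) * of_nat (j choose x)"
  proof (cases j)
    case 0
    then show ?thesis using top by simp
  next
    case (Suc j')
    have "(if j = 0 then 0 else box_entry D g i (j - 1)) = coeff g (Suc D - j) * of_nat (j' choose x)"
    proof -
      have "j' \<le> D" "D \<le> i + j'" "i + j' - D = x" using True ij Suc by linarith+
      then show ?thesis by (simp add: box_entry_def Suc)
    qed
    moreover have "(if i = 0 \<or> j = 0 then 0 else box_entry D g (i - 1) (j - 1)) =
      coeff g (Suc D - j) * of_nat (if x = 0 then 0 else j' choose (x - 1))"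
    proof (cases "x = 0")
      case True
      then have "i = 0 \<or> \<not> D \<le> i - 1 + j'" using ij Suc by linarith
      then show ?thesis using True by (auto simp: box_entry_def Suc)
    next
      case False
      then have "i \<noteq> 0" "j' \<le> D" "D \<le> i - 1 + j'" "i - 1 + j' - D = x - 1"
        using True ij Suc by linarith+
      then show ?thesis using False by (simp add: box_entry_def Suc)
    qed
    moreover have "j choose x = (j' choose x) + (if x = 0 then 0 else j' choose (x - 1))"
      unfolding Suc by (cases x) auto
    ultimately show ?thesis by (simp add: distrib_left)
  qed
  show ?thesis unfolding lhs add.assoc two one by (simp add: distrib_right)
qed

lemma sum_pair_index:
  fixes f :: "nat \<Rightarrow> 'a::comm_monoid_add"
  shows "(\<Sum>t<r * s. f t) = (\<Sum>i<r. \<Sum>j<s. f (i * s + j))"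
proof -
  have "(\<Sum>j<s. f (i * s + j)) = sum f {i * s..<i * s + s}" for i
    by (rule sum.reindex_bij_witness[of _ "\<lambda>t. t - i * s" "\<lambda>j. i * s + j"]) auto
  then show ?thesis by (simp add: sum.nat_group)
qed

lemma kronecker_jordan_mult_box_vec:
  fixes F :: "nat \<Rightarrow> nat \<Rightarrow> 'a::field"
  shows "kronecker_mat (jordan_block r 1) (jordan_block s 1) *\<^sub>v box_vec r s F =
    box_vec r s F + box_vec r s (\<lambda>i j. (if i = 0 then 0 else F (i - 1) j) +
      (if j = 0 then 0 else F i (j - 1)) + (if i = 0 \<or> j = 0 then 0 else F (i - 1) (j - 1)))"
    (is "?K *\<^sub>v _ = ?R")
proof (rule eq_vecI)
  show "dim_vec (?K *\<^sub>v box_vec r s F) = dim_vec ?R"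
    by (simp add: kronecker_mat_def box_vec_def)
next
  fix t assume "t < dim_vec ?R"
  then have t: "t < r * s" by (simp add: box_vec_def)
  define i0 j0 where "i0 = t div s" and "j0 = t mod s"
  have s: "0 < s" using t by (cases s) auto
  have ij: "i0 < r" "j0 < s"
    using t s unfolding i0_def j0_def by (auto simp: less_mult_imp_div_less)
  have K: "?K \<in> carrier_mat (r * s) (r * s)" by (simp add: kronecker_mat_def)
  have lt: "i * s + j < r * s" if "i < r" "j < s" for i j
  proof -
    have "i * s + j < Suc i * s" using that by simp
    also have "\<dots> \<le> r * s" using that by (intro mult_le_mono1) auto
    finally show ?thesis .
  qed
  have "(?K *\<^sub>v box_vec r s F) $ t = (\<Sum>t'<r * s. ?K $$ (t, t') * box_vec r s F $ t')"
    using K t by (intro mult_mat_vec_nth) (auto simp: box_vec_def)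
  also have "\<dots> = (\<Sum>i<r. \<Sum>j<s. jordan_block r 1 $$ (i0, i) * jordan_block s 1 $$ (j0, j) *
      F (r - 1 - i) (s - 1 - j))"
    unfolding sum_pair_index using t
    by (intro sum.cong refl) (simp add: kronecker_mat_def box_vec_def lt i0_def j0_def
        del: jordan_block_index(1))
  also have "\<dots> = (\<Sum>i<r. jordan_block r 1 $$ (i0, i) *
      (\<Sum>j<s. jordan_block s 1 $$ (j0, j) * F (r - 1 - i) (s - 1 - j)))"
    by (simp add: sum_distrib_left mult.assoc del: jordan_block_index(1))
  also have "\<dots> = ?R $ t"
    unfolding jordan_block_row_sum[OF ij(2)] jordan_block_row_sum[OF ij(1)]
    using t ij unfolding box_vec_def by (auto simp: i0_def[symmetric] j0_def[symmetric] Suc_diff_Suc)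
  finally show "(?K *\<^sub>v box_vec r s F) $ t = ?R $ t" .
qed

definition form_vec :: "nat \<Rightarrow> nat \<Rightarrow> nat \<Rightarrow> 'a::field poly \<Rightarrow> 'a vec" where
  "form_vec r s D g = box_vec r s (box_entry D g)"

lemma form_vec_carrier [simp]: "form_vec r s D g \<in> carrier_vec (r * s)"
  by (simp add: form_vec_def box_vec_def)

lemma kronecker_jordan_mult_form_vec:
  fixes g :: "'a::field poly"
  assumes "degree g \<le> D"
  shows "kronecker_mat (jordan_block r 1) (jordan_block s 1) *\<^sub>v form_vec r s D g =
    form_vec r s D g + form_vec r s (Suc D) (zform * g)"
  unfolding form_vec_def kronecker_jordan_mult_box_vec box_entry_step[OF assms] ..

lemma form_vec_eq_0:
  assumes "in_box_ideal r s D g"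
  shows "form_vec r s D g = 0\<^sub>v (r * s)"
proof (rule eq_vecI)
  fix t assume "t < dim_vec (0\<^sub>v (r * s) :: 'a vec)"
  then have t: "t < r * s" by simp
  then have "0 < r" "0 < s" by (auto intro: gr0I)
  then have "r - 1 - t div s < r" "s - 1 - t mod s < s" by auto
  then have "box_entry D g (r - 1 - t div s) (s - 1 - t mod s) = 0"
    using assms unfolding in_box_ideal_def box_entry_def by auto
  then show "form_vec r s D g $ t = 0\<^sub>v (r * s) $ t"
    using t by (simp add: form_vec_def box_vec_def)
qed (simp add: form_vec_def box_vec_def)

text \<open>The lowest terms of the form of degree \<open>D\<close>, in total degree \<open>D\<close>, are not changed by the substitution.
  In a relation between forms of distinct degrees outside the ideal, look at the least degree.\<close>
lemma form_vec_independent: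
  fixes g :: "nat \<Rightarrow> 'a::field poly"
  assumes inj: "inj_on E {..<n}"
    and nz: "\<And>d. d < n \<Longrightarrow> \<not> in_box_ideal r s (E d) (g d)"
    and zero: "\<And>t. t < r * s \<Longrightarrow> (\<Sum>d<n. c d * form_vec r s (E d) (g d) $ t) = 0"
  shows "\<forall>d<n. c d = 0"
proof (rule ccontr)
  assume "\<not> ?thesis"
  then obtain d0 where "d0 < n \<and> c d0 \<noteq> 0" by blast
  then obtain d where d: "d < n" "c d \<noteq> 0" and min: "\<And>d'. d' < n \<Longrightarrow> c d' \<noteq> 0 \<Longrightarrow> E d \<le> E d'"
    using ex_has_least_nat[of "\<lambda>d. d < n \<and> c d \<noteq> 0" d0 E] by blast
  obtain l where l: "l \<le> E d" "l < r" "E d - l < s" "coeff (g d) l \<noteq> 0"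
    using nz[OF d(1)] unfolding in_box_ideal_def by blast
  define j where "j = E d - l"
  define t where "t = (r - 1 - l) * s + (s - 1 - j)"
  have j: "j < s" using l by (simp add: j_def)
  have "t < Suc (r - 1 - l) * s" using j by (simp add: t_def)
  also have "\<dots> \<le> r * s" using l by (intro mult_le_mono1) auto
  finally have t: "t < r * s" .
  have divmod: "(a * s + b) div s = a" "(a * s + b) mod s = b" if "b < s" for a b
    using that by auto
  have "s - 1 - j < s" using j by simp
  then have idx: "r - 1 - t div s = l" "s - 1 - t mod s = j"
    unfolding t_def using divmod[of "s - 1 - j"] j l by (simp_all only:)
  have ent: "form_vec r s D h $ t = box_entry D h l j" for D and h :: "'a poly"
    by (simp only: form_vec_def box_vec_def index_vec[OF t] idx)
  have "c d' * box_entry (E d') (g d') l j = 0" if "d' < n" "d' \<noteq> d" for d'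
  proof (cases "c d' = 0")
    case False
    have "E d' \<noteq> E d" using inj that d(1) by (auto dest: inj_onD)
    then have "E d < E d'" using min[OF that(1) False] by simp
    then show ?thesis using l by (simp add: box_entry_def j_def)
  qed simp
  then have "(\<Sum>d'\<in>{..<n} - {d}. c d' * box_entry (E d') (g d') l j) = 0"
    by (intro sum.neutral) blast
  then have "(\<Sum>d'<n. c d' * form_vec r s (E d') (g d') $ t) = c d * box_entry (E d) (g d) l j"
    unfolding ent using d(1) by (subst sum.remove[of _ d]) simp_all
  also have "\<dots> = c d * coeff (g d) l" using l by (simp add: box_entry_def j_def)
  finally show False using zero[OF t] d(2) l(4) by simp
qed

section \<open>Jordan partitions from Lefschetz sets\<close>

definition lefschetz_set :: "'a::field itself \<Rightarrow> nat \<Rightarrow> nat \<Rightarrow> nat set" where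
  "lefschetz_set F r s = {k. k \<le> r \<and> lefschetz F r s k}"

text \<open>The elements of \<open>S\<close> cut the natural numbers into gaps; \<open>gap_start S d\<close> and \<open>gap_end S d\<close> are the two
  consecutive elements of \<open>S\<close> between which \<open>d\<close> lies, with \<open>d\<close> allowed to be the left one.\<close>
definition gap_start :: "nat set \<Rightarrow> nat \<Rightarrow> nat" where
  "gap_start S d = (GREATEST k. k \<in> S \<and> k \<le> d)"

definition gap_end :: "nat set \<Rightarrow> nat \<Rightarrow> nat" where
  "gap_end S d = (LEAST k. k \<in> S \<and> d < k)"

text \<open>For the Lefschetz set and \<open>N = r + s\<close>, the length of the string that starts in degree \<open>d\<close>.\<close>
definition string_length :: "nat set \<Rightarrow> nat \<Rightarrow> nat \<Rightarrow> nat" where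
  "string_length S N d = N - gap_start S d - gap_end S d"

context
  fixes S :: "nat set" and r :: nat
  assumes zero: "0 \<in> S" and top: "r \<in> S"
begin

lemma gap_start: "gap_start S d \<in> S \<and> gap_start S d \<le> d"
  unfolding gap_start_def by (rule GreatestI_nat[where P = "\<lambda>k. k \<in> S \<and> k \<le> d" and k = 0 and b = d]) (use zero in auto)

lemma le_gap_start: "k \<in> S \<Longrightarrow> k \<le> d \<Longrightarrow> k \<le> gap_start S d"
  unfolding gap_start_def by (rule Greatest_le_nat[where P = "\<lambda>k. k \<in> S \<and> k \<le> d" and b = d]) auto

lemma gap_end: "d < r \<Longrightarrow> gap_end S d \<in> S \<and> d < gap_end S d"
  unfolding gap_end_def by (rule LeastI[where P = "\<lambda>k. k \<in> S \<and> d < k" and k = r]) (use top in auto)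

lemma gap_end_le: "k \<in> S \<Longrightarrow> d < k \<Longrightarrow> gap_end S d \<le> k"
  unfolding gap_end_def by (rule Least_le) auto

lemma gap_end_le_top: "d < r \<Longrightarrow> gap_end S d \<le> r"
  using gap_end_le top by blast

lemma not_in_gap: "d < r \<Longrightarrow> gap_start S d < k \<Longrightarrow> k < gap_end S d \<Longrightarrow> k \<notin> S"
  using gap_end_le le_gap_start by (meson not_le)

lemma gap_cases:
  assumes "d < d'" "d' < r"
  shows "gap_start S d = gap_start S d' \<and> gap_end S d = gap_end S d' \<or> gap_end S d \<le> gap_start S d'"
proof (cases "gap_end S d \<le> d'")
  case True
  then show ?thesis using le_gap_start gap_end[of d] assms by auto
next
  case False
  have *: "gap_start S d' \<le> d"
    using False gap_end_le[of "gap_start S d'" d] gap_start[of d'] by linarith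
  show ?thesis
    using * False assms gap_start[of d] gap_start[of d'] gap_end[of d] gap_end[of d']
      le_gap_start[of "gap_start S d" d'] le_gap_start[of "gap_start S d'" d]
      gap_end_le[of "gap_end S d'" d] gap_end_le[of "gap_end S d" d']
    by (meson le_antisym less_le_trans not_le order.strict_trans order.trans less_imp_le)
qed

lemma string_length_antimono:
  assumes "d \<le> d'" "d' < r"
  shows "string_length S N d' \<le> string_length S N d"
proof (cases "d = d'")
  case False
  then have "d < d'" using assms by simp
  from gap_cases[OF this assms(2)] show ?thesis
    using gap_start[of d] gap_end[of d'] gap_end[of d] gap_start[of d'] assms
    unfolding string_length_def by auto
qed simp

lemma string_length_Suc_eq_iff:
  assumes d: "Suc d < r" and N: "2 * r \<le> N"
  shows "string_length S N d = string_length S N (Suc d) \<longleftrightarrow> Suc d \<notin> S"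
proof
  assume "Suc d \<notin> S"
  then have "gap_start S (Suc d) \<noteq> Suc d" using gap_start by metis
  then have "\<not> gap_end S d \<le> gap_start S (Suc d)"
    using gap_end[of d] gap_start[of "Suc d"] d by linarith
  then show "string_length S N d = string_length S N (Suc d)"
    using gap_cases[of d "Suc d"] d unfolding string_length_def by auto
next
  assume eq: "string_length S N d = string_length S N (Suc d)"
  show "Suc d \<notin> S"
  proof
    assume "Suc d \<in> S"
    then have "gap_end S d = Suc d" "gap_start S (Suc d) = Suc d"
      using gap_end_le[of "Suc d" d] gap_end[of d] le_gap_start[of "Suc d" "Suc d"]
        gap_start[of "Suc d"] d by auto
    then show False
      using eq gap_start[of d] gap_end[of "Suc d"] gap_end_le_top[of "Suc d"] d N
      unfolding string_length_def by linarith
  qed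
qed

text \<open>A gap from \<open>k0\<close> to \<open>k\<close> contributes \<open>(k - k0) (N - k0 - k)\<close>, a difference of values of \<open>k (N - k)\<close>.\<close>
lemma sum_string_length:
  assumes N: "2 * r \<le> N" and k: "k \<in> S" "k \<le> r"
  shows "(\<Sum>d<k. string_length S N d) = k * (N - k)"
  using k
proof (induction k rule: less_induct)
  case (less k)
  show ?case
  proof (cases "k = 0")
    case False
    define k0 where "k0 = gap_start S (k - 1)"
    have k0: "k0 \<in> S" "k0 < k" unfolding k0_def using gap_start[of "k - 1"] False by auto
    have gap: "gap_start S d = k0 \<and> gap_end S d = k" if "k0 \<le> d" "d < k" for d
    proof
      have "gap_start S d \<le> k0"
        unfolding k0_def using gap_start[of d] that by (intro le_gap_start) auto
      then show "gap_start S d = k0" using le_gap_start[of k0 d] k0 that by simp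
      have "\<not> gap_end S d < k"
        using gap_end[of d] le_gap_start[of "gap_end S d" "k - 1"] that less.prems
        unfolding k0_def by (metis Suc_pred' False less_Suc_eq_le not_le order.strict_trans2 gr0I)
      then show "gap_end S d = k" using gap_end_le[of k d] that less.prems by simp
    qed
    have "(\<Sum>d<k. string_length S N d) =
        (\<Sum>d<k0. string_length S N d) + (\<Sum>d=k0..<k. string_length S N d)"
      using k0 by (simp add: lessThan_atLeast0 sum.atLeastLessThan_concat)
    also have "(\<Sum>d=k0..<k. string_length S N d) = (k - k0) * (N - k0 - k)"
      using gap by (simp add: string_length_def)
    also have "(\<Sum>d<k0. string_length S N d) = k0 * (N - k0)"
      using less.IH[OF k0(2,1)] k0 less.prems by simp
    also have "k0 * (N - k0) + (k - k0) * (N - k0 - k) = k * (N - k)"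
    proof -
      define x y where "x = k - k0" and "y = N - k0 - k"
      have "N - k0 = k + y" "N - k0 - k = y" "N - k = k0 + y" "k - k0 = x" and k: "k = k0 + x"
        using k0(2) N less.prems(2) by (auto simp: x_def y_def)
      then have "k0 * (N - k0) + (k - k0) * (N - k0 - k) = k0 * (k + y) + x * y"
        "k * (N - k) = k * (k0 + y)" by (simp_all only:)
      moreover have "k0 * (k + y) + x * y = k * (k0 + y)" unfolding k by (simp add: algebra_simps)
      ultimately show ?thesis by (simp only:)
    qed
    finally show ?thesis .
  qed simp
qed

text \<open>Within a gap the last degrees of the strings increase with \<open>d\<close>, and they fill an interval that lies
  above the interval of any later gap.\<close>
lemma string_top_degree_inj:
  assumes N: "2 * r \<le> N"
  shows "inj_on (\<lambda>d. d + string_length S N d - 1) {..<r}"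
proof -
  have "d + string_length S N d - 1 \<noteq> d' + string_length S N d' - 1" if "d < d'" "d' < r" for d d'
  proof -
    have "0 < string_length S N d'" "0 < string_length S N d"
      using gap_end_le_top[of d] gap_end_le_top[of d'] gap_start[of d] gap_start[of d'] that N
      unfolding string_length_def by linarith+
    then show ?thesis
      using gap_cases[OF that] gap_end_le_top[of d] gap_end_le_top[of d'] gap_start[of d]
        gap_start[of d'] gap_end[of d] gap_end[of d'] that N
      unfolding string_length_def by linarith
  qed
  then show ?thesis unfolding inj_on_def by (metis lessThan_iff linorder_neqE_nat)
qed

end

lemma string_generator_of_degree:
  assumes rs: "r \<le> s" and d: "d < r"
  defines "S \<equiv> lefschetz_set TYPE('a::field) r s"
  defines "L \<equiv> string_length S (r + s) d"
  obtains f :: "'a::field poly" where "degree f \<le> d"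
    "in_box_ideal r s (d + L) (zform ^ L * f)"
    "\<not> in_box_ideal r s (d + L - 1) (zform ^ (L - 1) * f)"
proof -
  have z: "0 \<in> S" and t: "r \<in> S"
    using lefschetz_top[OF rs] by (auto simp: S_def lefschetz_set_def lefschetz_def)
  define k0 k1 where "k0 = gap_start S d" and "k1 = gap_end S d"
  have k: "k0 \<le> d" "d < k1" "k1 \<le> r" "k1 \<in> S"
    unfolding k0_def k1_def
    using gap_start[OF z t] gap_end[OF z t d] gap_end_le_top[OF z t d] by auto
  have gap: "\<not> lefschetz TYPE('a) r s k" if "k0 < k" "k < k1" for k
    using not_in_gap[OF z t d, of k] that k unfolding k0_def k1_def S_def lefschetz_set_def by auto
  have lef: "lefschetz TYPE('a) r s k1" using k unfolding S_def lefschetz_set_def by simp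
  have "k0 < k1" using k by simp
  then obtain w :: "'a poly" where w:
    "in_box_ideal r s (r + s - k1) (zform ^ (r + s - k0 - k1) * w)"
    "\<not> in_box_ideal r s (r + s - k1 - 1) (zform ^ (r + s - k0 - k1 - 1) * w)" "degree w \<le> k0"
    using string_generator[OF _ k(3) rs lef] gap by metis
  have L: "L = r + s - k0 - k1" unfolding L_def string_length_def k0_def k1_def ..
  have Lpos: "0 < L" using k rs d unfolding L by linarith
  let ?f = "monom 1 (d - k0) * w"
  have comm: "zform ^ m * ?f = monom 1 (d - k0) * (zform ^ m * w)" for m
    by (simp only: mult.left_commute)
  show ?thesis
  proof (rule that[of ?f])
    show "degree ?f \<le> d"
      using degree_mult_le[of "monom (1::'a) (d - k0)" w] w(3) k(1) by (simp add: degree_monom_eq)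
    have "d + L = r + s - k1 + (d - k0)" using k rs d unfolding L by linarith
    then show "in_box_ideal r s (d + L) (zform ^ L * ?f)"
      unfolding comm using in_box_ideal_monom_mult[OF w(1), of "d - k0"] by (simp only: L)
    have "\<not> in_box_ideal r s (r + s - k1 - 1 + (d - k0)) (monom 1 (d - k0) * (zform ^ (L - 1) * w))"
    proof (rule string_shift_nonzero[OF _ k(3) rs])
      have "zform * (zform ^ (L - 1) * w) = zform ^ L * w"
        using Lpos by (metis Suc_pred' mult.assoc power_Suc)
      then show "in_box_ideal r s (r + s - k1) (zform * (zform ^ (L - 1) * w))"
        using w(1) by (simp only: L)
    qed (use k w(2) in \<open>auto simp: L\<close>)
    moreover have "d + L - 1 = r + s - k1 - 1 + (d - k0)" using k rs d unfolding L by linarith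
    ultimately show "\<not> in_box_ideal r s (d + L - 1) (zform ^ (L - 1) * ?f)"
      unfolding comm by simp
  qed
qed

text \<open>One string starts in each degree \<open>d < r\<close>.  The strings end in distinct degrees, so their last elements
  are independent, and hence so are all their elements.  Since the lengths add up to \<open>r s\<close>, the strings
  form a Jordan basis.\<close>
theorem jordan_partition_eq_string_lengths:
  assumes rs: "r \<le> s"
  shows "jordan_partition TYPE('a::field) r s =
    map (string_length (lefschetz_set TYPE('a) r s) (r + s)) [0..<r]"
proof -
  define S where "S = lefschetz_set TYPE('a) r s"
  define L where "L = string_length S (r + s)"
  let ?K = "kronecker_mat (jordan_block r (1::'a)) (jordan_block s 1)"
  have z: "0 \<in> S" and t: "r \<in> S"
    using lefschetz_top[OF rs] by (auto simp: S_def lefschetz_set_def lefschetz_def)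
  have N: "2 * r \<le> r + s" using rs by simp
  have pos: "0 < L d" if "d < r" for d
    using gap_end_le_top[OF z t that] gap_start[OF z t, of d] that rs
    unfolding L_def string_length_def by linarith
  have "\<exists>f :: 'a poly. degree f \<le> d \<and> in_box_ideal r s (d + L d) (zform ^ L d * f) \<and>
      \<not> in_box_ideal r s (d + L d - 1) (zform ^ (L d - 1) * f)" if "d < r" for d
    using string_generator_of_degree[OF rs that, where 'a = 'a] unfolding L_def S_def by metis
  then obtain f :: "nat \<Rightarrow> 'a poly" where f: "\<And>d. d < r \<Longrightarrow> degree (f d) \<le> d"
    "\<And>d. d < r \<Longrightarrow> in_box_ideal r s (d + L d) (zform ^ L d * f d)"
    "\<And>d. d < r \<Longrightarrow> \<not> in_box_ideal r s (d + L d - 1) (zform ^ (L d - 1) * f d)"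
    by metis
  \<comment> \<open>The Jordan basis: position \<open>i\<close> counts from the end of the string, where the eigenvector is.\<close>
  define u where "u d i = form_vec r s (d + (L d - 1 - i)) (zform ^ (L d - 1 - i) * f d)" for d i
  have chain: "jordan_chain (r * s) ?K (L d) (u d)" if d: "d < r" for d
    unfolding jordan_chain_def
  proof (intro allI impI conjI)
    fix i assume i: "i < L d"
    show "u d i \<in> carrier_vec (r * s)" unfolding u_def by simp
    have step: "?K *\<^sub>v u d i = u d i +
        form_vec r s (Suc (d + (L d - 1 - i))) (zform * (zform ^ (L d - 1 - i) * f d))"
      unfolding u_def
      by (intro kronecker_jordan_mult_form_vec degree_zform_power_mult_le f(1) d)
    have "Suc (d + (L d - 1 - i)) = d + (L d - i)"
      "zform * (zform ^ (L d - 1 - i) * f d) = zform ^ (L d - i) * f d"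
      using i by (auto simp: Suc_diff_Suc simp flip: mult.assoc power_Suc)
    then have "form_vec r s (Suc (d + (L d - 1 - i))) (zform * (zform ^ (L d - 1 - i) * f d)) =
        form_vec r s (d + (L d - i)) (zform ^ (L d - i) * f d)" by (simp only:)
    also have "\<dots> = (if i = 0 then 0\<^sub>v (r * s) else u d (i - 1))"
    proof (cases "i = 0")
      case True
      then show ?thesis using form_vec_eq_0[OF f(2)[OF d]] by simp
    next
      case False
      then have "L d - i = L d - 1 - (i - 1)" using i by simp
      then show ?thesis using False unfolding u_def by simp
    qed
    finally show "?K *\<^sub>v u d i = u d i + (if i = 0 then 0\<^sub>v (r * s) else u d (i - 1))"
      unfolding step by simp
  qed
  have nf: "jordan_nf ?K (map (\<lambda>m. (m, 1)) (map L [0..<r]))"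
  proof (rule jordan_nf_from_chains[where N = "r * s" and u = u])
    show "?K \<in> carrier_mat (r * s) (r * s)" by (simp add: kronecker_mat_def)
    show "sum_list (map L [0..<r]) = r * s"
      using sum_string_length[OF z t N t]
      by (simp add: L_def interv_sum_list_conv_sum_set_nat lessThan_atLeast0)
    show "jordan_chain (r * s) ?K (map L [0..<r] ! d) (u d)" if "d < length (map L [0..<r])" for d
      using chain that by simp
    show "0 < map L [0..<r] ! d" if "d < length (map L [0..<r])" for d
      using pos that by simp
    fix c :: "nat \<Rightarrow> 'a"
    assume c: "\<And>t. t < r * s \<Longrightarrow> (\<Sum>d<length (map L [0..<r]). c d * u d 0 $ t) = 0"
    have "\<forall>d<r. c d = 0"
    proof (rule form_vec_independent[where E = "\<lambda>d. d + L d - 1" and g = "\<lambda>d. zform ^ (L d - 1) * f d"])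
      show "inj_on (\<lambda>d. d + L d - 1) {..<r}"
        unfolding L_def by (rule string_top_degree_inj[OF z t N])
      show "\<not> in_box_ideal r s (d + L d - 1) (zform ^ (L d - 1) * f d)" if "d < r" for d
        by (rule f(3)[OF that])
      fix t' assume t': "t' < r * s"
      have "(\<Sum>d<r. c d * form_vec r s (d + L d - 1) (zform ^ (L d - 1) * f d) $ t') =
          (\<Sum>d<r. c d * u d 0 $ t')"
        using pos by (intro sum.cong refl) (auto simp: u_def Suc_leI)
      then show "(\<Sum>d<r. c d * form_vec r s (d + L d - 1) (zform ^ (L d - 1) * f d) $ t') = 0"
        using c[OF t'] by simp
    qed
    then show "\<forall>d<length (map L [0..<r]). c d = 0" by simp
  qed
  have "sorted_wrt (\<ge>) (map L [0..<r])"
    unfolding sorted_wrt_iff_nth_less L_def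
    using string_length_antimono[OF z t] by auto
  with nf have "is_jordan_partition TYPE('a) r s (map L [0..<r])"
    unfolding is_jordan_partition_def by simp
  then show ?thesis
    using ex1_jordan_partition is_jordan_partition_jordan_partition unfolding L_def S_def by blast
qed

section \<open>Multiplicity compositions\<close>

lemma multiplicity_composition_map_inj:
  assumes "inj f"
  shows "multiplicity_composition (map f \<nu>) = multiplicity_composition \<nu>"
  unfolding multiplicity_composition_def
  using assms by (simp add: remdups_adj_map_injective count_list_map_conv comp_def)

lemma multiplicity_composition_first_block:
  assumes "sorted_wrt (\<ge>) (x # xs)"
  obtains c rest where "x # xs = replicate (Suc c) x @ rest" "x \<notin> set rest" "sorted_wrt (\<ge>) rest"
    "multiplicity_composition (x # xs) = Suc c # multiplicity_composition rest"
proof -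
  define c rest where "c = length (takeWhile ((=) x) xs)" and "rest = dropWhile ((=) x) xs"
  have tw: "takeWhile ((=) x) xs = replicate c x"
    unfolding c_def by (induction xs) auto
  have eq: "x # xs = replicate (Suc c) x @ rest"
    using takeWhile_dropWhile_id[of "(=) x" xs] unfolding tw rest_def by simp
  have srt: "sorted_wrt (\<ge>) rest" and le: "\<forall>y\<in>set rest. y \<le> x"
    using assms unfolding eq by (auto simp: sorted_wrt_append)
  have notin: "x \<notin> set rest"
  proof (cases rest)
    case (Cons y ys)
    then have "y \<noteq> x" using hd_dropWhile[of "(=) x" xs] unfolding rest_def by auto
    then show ?thesis using srt le unfolding Cons by auto
  qed simp
  have "remdups_adj (replicate (Suc c) x @ rest) = x # remdups_adj rest"
  proof (induction c)
    case 0
    show ?case using notin by (cases rest) auto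
  qed simp
  moreover have "count_list (replicate n x @ rest) y = count_list rest y" if "y \<in> set rest" for y n
    using that notin by (induction n) auto
  moreover have "count_list (replicate n x @ rest) x = n" for n
    using notin by (induction n) (auto simp: count_list_0_iff)
  ultimately have "multiplicity_composition (x # xs) = Suc c # multiplicity_composition rest"
    unfolding multiplicity_composition_def eq using notin by auto
  then show ?thesis using that eq notin srt by blast
qed

text \<open>Both lists begin with a block of equal entries whose length is the first multiplicity.  Stripping it
  from both leaves shorter lists with equal multiplicities.\<close>
lemma multiplicity_composition_breaks:
  assumes "sorted_wrt (\<ge>) xs" "sorted_wrt (\<ge>) ys" "length xs = length ys"
    "multiplicity_composition xs = multiplicity_composition ys" "Suc i < length xs"
  shows "xs ! i = xs ! Suc i \<longleftrightarrow> ys ! i = ys ! Suc i"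
  using assms
proof (induction "length xs" arbitrary: xs ys i rule: less_induct)
  case less
  obtain x xs' y ys' where xy: "xs = x # xs'" "ys = y # ys'"
    using less.prems by (cases xs; cases ys) auto
  obtain c rest where c: "xs = replicate (Suc c) x @ rest" "x \<notin> set rest" "sorted_wrt (\<ge>) rest"
    "multiplicity_composition xs = Suc c # multiplicity_composition rest"
    using multiplicity_composition_first_block[of x xs'] less.prems(1) unfolding xy(1) by metis
  obtain c' rest' where c': "ys = replicate (Suc c') y @ rest'" "y \<notin> set rest'" "sorted_wrt (\<ge>) rest'"
    "multiplicity_composition ys = Suc c' # multiplicity_composition rest'"
    using multiplicity_composition_first_block[of y ys'] less.prems(2) unfolding xy(2) by metis
  have cc: "c' = c" and mc: "multiplicity_composition rest = multiplicity_composition rest'"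
    using less.prems(4) c(4) c'(4) by auto
  have len: "length rest = length rest'" "length xs = Suc c + length rest"
    using less.prems(3) c(1) c'(1) cc by auto
  have nth: "xs ! j = (if j \<le> c then x else rest ! (j - Suc c))"
    "ys ! j = (if j \<le> c then y else rest' ! (j - Suc c))" if "j < length xs" for j
    unfolding c(1) c'(1) cc by (auto simp: nth_append less_Suc_eq_le simp del: replicate_Suc)
  consider "i < c" | "i = c" | "c < i" by linarith
  then show ?case
  proof cases
    case 1
    then show ?thesis using nth[of i] nth[of "Suc i"] less.prems(5) by simp
  next
    case 2
    then have "rest ! 0 \<in> set rest" "rest' ! 0 \<in> set rest'"
      using less.prems(5) len by (auto intro!: nth_mem)
    then show ?thesis using 2 nth[of i] nth[of "Suc i"] less.prems(5) c(2) c'(2) by auto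
  next
    case 3
    have "rest ! (i - Suc c) = rest ! Suc (i - Suc c) \<longleftrightarrow> rest' ! (i - Suc c) = rest' ! Suc (i - Suc c)"
      by (rule less.hyps[OF _ c(3) c'(3) len(1) mc]) (use 3 less.prems(5) len in auto)
    then show ?thesis using 3 nth[of i] nth[of "Suc i"] less.prems(5) by (simp add: Suc_diff_Suc Suc_diff_le)
  qed
qed

section \<open>Periodicity of Lefschetz sets and its end\<close>

lemma lefschetz_iff_carry_free:
  assumes p: "prime p" "CHAR('a::field) = p" and k: "0 < k" "k \<le> r" "r \<le> s"
  shows "lefschetz TYPE('a) r s k \<longleftrightarrow> (\<forall>e\<ge>1. box_carry_free (p ^ e) (r - k) (s - k) k)"
  unfolding lefschetz_iff_det[OF k] of_int_eq_0_iff_char_dvd p(2)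
    prime_dvd_det_shifted_binomial_mat_iff[OF p(1)] by blast

lemma box_carry_free_small:
  assumes "a + b + k \<le> Q"
  shows "box_carry_free Q a b k"
  unfolding box_carry_free_def
  using assms mod_less_eq_dividend[of a Q] mod_less_eq_dividend[of b Q] mod_less_eq_dividend[of k Q]
  by linarith

lemma box_carry_free_add_period:
  "Q dvd q \<Longrightarrow> box_carry_free Q a (b + q) k \<longleftrightarrow> box_carry_free Q a b k"
  unfolding box_carry_free_def by (simp add: mod_add_right_eq[of b q Q, symmetric])

text \<open>Here \<open>K\<close> is the quotient of \<open>r\<close> by \<open>q\<close>, rounded up.\<close>
context
  fixes p q n r K :: nat
  assumes p: "prime p" and n: "0 < n" and q: "q = p ^ (n - 1)"
    and K: "(K - 1) * q < r" "r \<le> K * q" "2 \<le> K" "2 * K \<le> p"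
begin

lemma power_n_eq: "p ^ n = p * q"
  using n unfolding q by (cases n) auto

lemma power_dvd_q: "e < n \<Longrightarrow> p ^ e dvd q"
  unfolding q by (rule le_imp_power_dvd) simp

lemma q_pos: "0 < q"
  using prime_gt_0_nat[OF p] unfolding q by simp

lemma period_le_power: "n \<le> e \<Longrightarrow> p * q \<le> p ^ e"
  using power_increasing[of n e p] prime_gt_0_nat[OF p] by (simp add: power_n_eq)

text \<open>Powers of \<open>p\<close> up to \<open>q\<close> do not notice the shift of \<open>s\<close> by \<open>q\<close>.  For larger powers the sum of the three
  arguments, \<open>r + s - k\<close> or \<open>r + s + q - k\<close>, is too small to exceed the power, except that the second one
  may exceed \<open>p q\<close>.  In that case the condition modulo \<open>q\<close> already fails, for both values of \<open>s\<close>.\<close>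
lemma carry_free_periodic:
  assumes k: "0 < k" "k < r" and s: "r \<le> s" "s \<le> (p - K) * q"
  shows "(\<forall>e\<ge>1. box_carry_free (p ^ e) (r - k) (s - k) k) \<longleftrightarrow>
    (\<forall>e\<ge>1. box_carry_free (p ^ e) (r - k) (s + q - k) k)"
proof -
  have sq: "s + q - k = (s - k) + q" using k s by simp
  have low: "box_carry_free (p ^ e) (r - k) (s + q - k) k \<longleftrightarrow> box_carry_free (p ^ e) (r - k) (s - k) k"
    if "e < n" for e
    unfolding sq by (rule box_carry_free_add_period[OF power_dvd_q[OF that]])
  have pK: "(p - K) * q + K * q = p * q" using K by (simp add: add_mult_distrib[symmetric])
  have rs: "r + s \<le> p * q" using pK K s by linarith
  have high: "box_carry_free (p ^ e) (r - k) (s - k) k" if "n \<le> e" for e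
    using period_le_power[OF that] rs k s by (intro box_carry_free_small) linarith
  show ?thesis
  proof (cases "r + s + q - k \<le> p * q")
    case True
    have "box_carry_free (p ^ e) (r - k) (s + q - k) k" if "n \<le> e" for e
      using period_le_power[OF that] True k s by (intro box_carry_free_small) linarith
    then show ?thesis using low high by (meson not_le)
  next
    case False
    \<comment> \<open>Now \<open>k < r1 - s1\<close>, and modulo \<open>q\<close> the arguments are \<open>r1 - k\<close>, \<open>q - s1 - k\<close> and \<open>k\<close>,
      with sum strictly between \<open>q\<close> and \<open>2 q\<close>.\<close>
    define r1 s1 where "r1 = r - (K - 1) * q" and "s1 = (p - K) * q - s"
    have Kq: "K * q = (K - 1) * q + q" using K by (cases K) auto
    have pKq: "(p - K) * q = (p - K - 1) * q + q" using K by (cases "p - K") auto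
    have r1: "r = (K - 1) * q + r1" "0 < r1" "r1 \<le> q" using K Kq by (auto simp: r1_def)
    have s1: "s + s1 = (p - K) * q" using s by (simp add: s1_def)
    have gap: "s1 + k < r1" using False r1 s1 pK Kq k by linarith
    have "r - k = (K - 1) * q + (r1 - k)" "s - k = (p - K - 1) * q + (q - s1 - k)"
      using gap r1 s1 pKq by linarith+
    moreover have "(a * q + b) mod q = b" if "b < q" for a b using that by simp
    moreover have "r1 - k < q" "q - s1 - k < q" "k < q" using gap r1 k by linarith+
    ultimately have "(r - k) mod q = r1 - k" "(s - k) mod q = q - s1 - k" "k mod q = k"
      by (simp_all only: mod_less)
    then have fail: "\<not> box_carry_free q (r - k) (s - k) k"
      unfolding box_carry_free_def using gap r1 k by auto
    have "1 < q" using gap r1 k by linarith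
    then have "n - 1 \<noteq> 0" unfolding q by (metis less_irrefl power_0)
    then have "1 \<le> n - 1" "n - 1 < n" by auto
    then show ?thesis using low[of "n - 1"] fail unfolding q by blast
  qed
qed

text \<open>At the first \<open>s\<close> outside the range of periodicity, take for \<open>k\<close> the residue of \<open>r\<close> modulo \<open>q\<close> in
  \<open>{1..q}\<close>.  Then \<open>r - k\<close> is a multiple of \<open>q\<close>, so no power below \<open>p\<^sup>n\<close> obstructs, and the sum of the
  arguments rises from at most \<open>p q\<close> to \<open>p q + 1\<close> under the shift.\<close>
lemma carry_free_breaks:
  defines "k \<equiv> r - (K - 1) * q" and "s \<equiv> (p - K) * q + 1"
  shows "0 < k" "k < r" "\<forall>e\<ge>1. box_carry_free (p ^ e) (r - k) (s - k) k"
    "\<not> box_carry_free (p ^ n) (r - k) (s + q - k) k"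
proof -
  have Kq: "K * q = (K - 1) * q + q" using K by (cases K) auto
  have "1 \<le> K - 1" using K(3) by linarith
  then have K1: "q \<le> (K - 1) * q" using mult_le_mono1[of 1 "K - 1" q] by simp
  have pK: "(p - K) * q + K * q = p * q" using K by (simp add: add_mult_distrib[symmetric])
  have pK': "K * q \<le> (p - K) * q" using K by (intro mult_le_mono1) simp
  have r: "r = (K - 1) * q + k" "0 < k" "k \<le> q" using K Kq by (auto simp: k_def)
  show k: "0 < k" "k < r" using r K1 q_pos by linarith+
  have rk: "r - k = (K - 1) * q" using r by linarith
  show "\<forall>e\<ge>1. box_carry_free (p ^ e) (r - k) (s - k) k"
  proof (intro allI impI)
    fix e :: nat
    show "box_carry_free (p ^ e) (r - k) (s - k) k"
    proof (cases "e < n")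
      case True
      then have "(r - k) mod p ^ e = 0" unfolding rk using power_dvd_q by simp
      then show ?thesis unfolding box_carry_free_def by simp
    next
      case False
      then have "p * q \<le> p ^ e" using period_le_power by simp
      then show ?thesis
        using r pK Kq K1 q_pos pK' unfolding s_def by (intro box_carry_free_small) linarith
    qed
  qed
  have "0 < (K - 1) * q" "(K - 1) * q < p * q" "0 < s + q - k" "s + q - k < p * q" "k < p * q"
    "(K - 1) * q + (s + q - k) + k = p * q + 1"
    using r pK Kq K1 q_pos pK' unfolding s_def by linarith+
  then show "\<not> box_carry_free (p ^ n) (r - k) (s + q - k) k"
    unfolding rk box_carry_free_def power_n_eq using r q_pos K by auto
qed

end

theorem theorem3:
  fixes p r n :: nat
  assumes "prime p" and "CHAR('a::field) = p"
    and "r > 0" and "n > 0"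
    and "real (p ^ (n - 1)) < real r"
    and "real r \<le> (real p - 1) / 2 * real (p ^ (n - 1))"
  shows "(\<forall>s::nat. r \<le> s \<and> s \<le> (p - nat \<lceil>real r / real (p ^ (n - 1))\<rceil>) * p ^ (n - 1) \<longrightarrow>
            jordan_composition TYPE('a) r s = jordan_composition TYPE('a) r (s + p ^ (n - 1)))
       \<and> jordan_composition TYPE('a) r ((p - nat \<lceil>real r / real (p ^ (n - 1))\<rceil>) * p ^ (n - 1) + 1)
         \<noteq> jordan_composition TYPE('a) r ((p - nat \<lceil>real r / real (p ^ (n - 1))\<rceil> + 1) * p ^ (n - 1) + 1)"
proof -
  define q where "q = p ^ (n - 1)"
  define K where "K = nat \<lceil>real r / real q\<rceil>"
  have q0: "0 < q" using prime_gt_0_nat[OF assms(1)] by (simp add: q_def)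
  have one: "1 < real r / real q" using assms(5) q0 by (simp add: q_def)
  then have Kr: "real K = of_int \<lceil>real r / real q\<rceil>" unfolding K_def by simp
  have Kbounds: "real K - 1 < real r / real q" "real r / real q \<le> real K"
    unfolding Kr by linarith+
  have K2: "2 \<le> K" using Kbounds one by linarith
  have "real r \<le> real K * real q" using Kbounds(2) q0 by (simp add: field_simps)
  then have Kup: "r \<le> K * q" by (metis of_nat_le_iff of_nat_mult)
  have "real (K - 1) * real q < real r" using Kbounds(1) q0 K2 by (simp add: field_simps of_nat_diff)
  then have Klow: "(K - 1) * q < r" by (metis of_nat_less_iff of_nat_mult)
  have "real r / real q \<le> (real p - 1) / 2"
    using assms(6) q0 unfolding q_def[symmetric] by (simp add: pos_divide_le_eq)
  then have "2 * (real K - 1) < real p - 1" using Kbounds(1) by argo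
  then have "real (2 * K) < real (p + 1)" by simp
  then have Kp: "2 * K \<le> p" by (simp only: of_nat_less_iff)
  note K = Klow Kup K2 Kp
  note ctx = assms(1,4) q_def K
  have rle: "r \<le> (p - K) * q"
    using Kup Kp mult_le_mono1[of K "p - K" q] by linarith
  have zero: "0 \<in> lefschetz_set TYPE('a) r s" and top: "r \<le> s \<Longrightarrow> r \<in> lefschetz_set TYPE('a) r s" for s
    using lefschetz_top[of r s, where 'a = 'a] by (auto simp: lefschetz_set_def lefschetz_def)
  have periodic: "jordan_composition TYPE('a) r s = jordan_composition TYPE('a) r (s + q)"
    if s: "r \<le> s" "s \<le> (p - K) * q" for s
  proof -
    \<comment> \<open>With equal Lefschetz sets every part grows by exactly \<open>q\<close>, which keeps the multiplicities.\<close>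
    have "k \<in> lefschetz_set TYPE('a) r s \<longleftrightarrow> k \<in> lefschetz_set TYPE('a) r (s + q)" for k
    proof -
      consider "k = 0" | "k = r" | "r < k" | "0 < k" "k < r" by linarith
      then show ?thesis
      proof cases
        case 4
        then show ?thesis
          unfolding lefschetz_set_def mem_Collect_eq
          using s carry_free_periodic[OF ctx 4 s]
            lefschetz_iff_carry_free[OF assms(1,2), of k r s]
            lefschetz_iff_carry_free[OF assms(1,2), of k r "s + q"] by simp
      qed (use zero top s in \<open>auto simp: lefschetz_set_def\<close>)
    qed
    then have S: "lefschetz_set TYPE('a) r (s + q) = lefschetz_set TYPE('a) r s" by blast
    let ?S = "lefschetz_set TYPE('a) r s"
    have "string_length ?S (r + (s + q)) d = q + string_length ?S (r + s) d" if "d < r" for d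
      using gap_start[OF zero top[OF s(1)], of d] gap_end_le_top[OF zero top[OF s(1)] that] that s(1)
      unfolding string_length_def by linarith
    then have "jordan_partition TYPE('a) r (s + q) = map ((+) q) (jordan_partition TYPE('a) r s)"
      using s by (simp add: jordan_partition_eq_string_lengths S)
    then show ?thesis
      unfolding jordan_composition_def by (simp add: multiplicity_composition_map_inj)
  qed
  define s where "s = (p - K) * q + 1"
  define k where "k = r - (K - 1) * q"
  note breaks = carry_free_breaks[OF ctx, folded k_def s_def]
  have rs: "r \<le> s" "r \<le> s + q" using rle by (auto simp: s_def)
  have inS: "k \<in> lefschetz_set TYPE('a) r s"
    using lefschetz_iff_carry_free[OF assms(1,2) breaks(1) _ rs(1)] breaks
    by (simp add: lefschetz_set_def)
  have notinS: "k \<notin> lefschetz_set TYPE('a) r (s + q)"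
    using lefschetz_iff_carry_free[OF assms(1,2) breaks(1) _ rs(2)] breaks assms(4)
    by (auto simp: lefschetz_set_def)
  \<comment> \<open>The partition drops between positions \<open>k - 1\<close> and \<open>k\<close> for \<open>s\<close> but not for \<open>s + q\<close>.\<close>
  have "jordan_composition TYPE('a) r s \<noteq> jordan_composition TYPE('a) r (s + q)"
  proof
    assume eq: "jordan_composition TYPE('a) r s = jordan_composition TYPE('a) r (s + q)"
    let ?\<nu> = "jordan_partition TYPE('a) r"
    have srt: "sorted_wrt (\<ge>) (?\<nu> x)" for x
      using is_jordan_partition_jordan_partition unfolding is_jordan_partition_def by blast
    have len: "length (?\<nu> x) = r" if "r \<le> x" for x
      using that by (simp add: jordan_partition_eq_string_lengths)
    have brk: "?\<nu> x ! (k - 1) = ?\<nu> x ! Suc (k - 1) \<longleftrightarrow> k \<notin> lefschetz_set TYPE('a) r x" if "r \<le> x" for x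
      using string_length_Suc_eq_iff[OF zero top[OF that], of "k - 1" "r + x"] breaks(1,2) that
      by (simp add: jordan_partition_eq_string_lengths)
    have "?\<nu> s ! (k - 1) = ?\<nu> s ! Suc (k - 1) \<longleftrightarrow> ?\<nu> (s + q) ! (k - 1) = ?\<nu> (s + q) ! Suc (k - 1)"
      using eq breaks(1,2) rs len unfolding jordan_composition_def
      by (intro multiplicity_composition_breaks srt) simp_all
    then show False using brk[OF rs(1)] brk[OF rs(2)] inS notinS by simp
  qed
  moreover have next_s: "(p - K + 1) * q + 1 = s + q" unfolding s_def by simp
  ultimately show ?thesis
    unfolding q_def[symmetric] K_def[symmetric] s_def[symmetric] next_s using periodic by blast
qed

end
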